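(* Let $\mathcal{M}$ be a ternary, homogeneous, supersimple structure with SU-rank 1. If $\mathcal{M}$ has only finitely many constraints (up to isomorphism), then algebraic closure $\mathrm{acl}_{\mathcal{M}}$ is trivial.
   Context: A structure is homogeneous if it is countable, has a finite relational vocabulary, and every isomorphism between finite substructures extends to an automorphism. Ternary: no relation symbol has arity greater than 3. A finite structure (same vocabulary) is permitted if it embeds into $\mathcal{M}$ and forbidden otherwise; a constraint of $\mathcal{M}$ is a finite forbidden structure all of whose proper substructures are permitted. Supersimplicity and SU-rank refer to $Th(\mathcal{M})$. $\mathrm{acl}_{\mathcal{M}}$ is trivial if whenever $A\subseteq M$, $b\in M$ and $b\in \mathrm{acl}_{\mathcal{M}}(A)$, then $b\in \mathrm{acl}_{\mathcal{M}}(a)$ for some $a\in A$.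
   Formalization: Triviality of acl is stated for nonempty A only: with A empty it would force acl(∅) = ∅, which fails for an infinite set with a unary predicate naming one point (SU-rank of the structure being the supremum over 1-types). *)

theory Defs
  imports Main "HOL-Library.Countable_Set" "HOL-Library.Extended_Nat"
begin

section \<open>Relational structures\<close>

record 'r vocab =
  syms :: "'r set"
  arity :: "'r \<Rightarrow> nat"

record ('r, 'a) struct =
  univ :: "'a set"
  rel :: "'r \<Rightarrow> 'a list set"

definition finite_relational :: "'r vocab \<Rightarrow> bool" where
  "finite_relational V \<longleftrightarrow> finite (syms V) \<and> (\<forall>R\<in>syms V. 1 \<le> arity V R)"

definition ternary :: "'r vocab \<Rightarrow> bool" where
  "ternary V \<longleftrightarrow> (\<forall>R\<in>syms V. arity V R \<le> 3)"

text \<open>The interpretation of symbols outside \<open>syms V\<close> is junk; no notion below looks at it.\<close>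

definition is_struct :: "'r vocab \<Rightarrow> ('r, 'a) struct \<Rightarrow> bool" where
  "is_struct V M \<longleftrightarrow> univ M \<noteq> {} \<and>
     (\<forall>R\<in>syms V. \<forall>xs\<in>rel M R. length xs = arity V R \<and> set xs \<subseteq> univ M)"

definition substruct :: "'r vocab \<Rightarrow> ('r, 'a) struct \<Rightarrow> ('r, 'a) struct \<Rightarrow> bool" where
  "substruct V A M \<longleftrightarrow> is_struct V A \<and> univ A \<subseteq> univ M \<and>
     (\<forall>R\<in>syms V. rel A R = rel M R \<inter> lists (univ A))"

definition embedding ::
  "'r vocab \<Rightarrow> ('r, 'a) struct \<Rightarrow> ('r, 'b) struct \<Rightarrow> ('a \<Rightarrow> 'b) \<Rightarrow> bool" where
  "embedding V A B f \<longleftrightarrow> inj_on f (univ A) \<and> f ` univ A \<subseteq> univ B \<and>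
     (\<forall>R\<in>syms V. \<forall>xs\<in>lists (univ A). xs \<in> rel A R \<longleftrightarrow> map f xs \<in> rel B R)"

definition iso ::
  "'r vocab \<Rightarrow> ('r, 'a) struct \<Rightarrow> ('r, 'b) struct \<Rightarrow> ('a \<Rightarrow> 'b) \<Rightarrow> bool" where
  "iso V A B f \<longleftrightarrow> embedding V A B f \<and> f ` univ A = univ B"

definition homogeneous :: "'r vocab \<Rightarrow> ('r, 'a) struct \<Rightarrow> bool" where
  "homogeneous V M \<longleftrightarrow> finite_relational V \<and> is_struct V M \<and> countable (univ M) \<and>
     (\<forall>A B f. substruct V A M \<and> substruct V B M \<and> finite (univ A) \<and> finite (univ B) \<and>
        iso V A B f \<longrightarrow> (\<exists>g. iso V M M g \<and> (\<forall>x\<in>univ A. g x = f x)))"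

definition permitted :: "'r vocab \<Rightarrow> ('r, 'a) struct \<Rightarrow> ('r, 'b) struct \<Rightarrow> bool" where
  "permitted V M F \<longleftrightarrow> (\<exists>f. embedding V F M f)"

definition is_constraint :: "'r vocab \<Rightarrow> ('r, 'a) struct \<Rightarrow> ('r, 'b) struct \<Rightarrow> bool" where
  "is_constraint V M F \<longleftrightarrow> is_struct V F \<and> finite (univ F) \<and> \<not> permitted V M F \<and>
     (\<forall>G. substruct V G F \<and> univ G \<noteq> univ F \<longrightarrow> permitted V M G)"

text \<open>Up to isomorphism every finite structure has its universe in \<^typ>\<open>nat\<close>.\<close>

definition finitely_constrained :: "'r vocab \<Rightarrow> ('r, 'a) struct \<Rightarrow> bool" where
  "finitely_constrained V M \<longleftrightarrow>
     (\<exists>C :: ('r, nat) struct set. finite C \<and>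
        (\<forall>F :: ('r, nat) struct. is_constraint V M F \<longrightarrow> (\<exists>G\<in>C. \<exists>f. iso V F G f)))"


section \<open>First-order logic\<close>

datatype 'r fm =
    Eq nat nat
  | Rel 'r "nat list"
  | Neg "'r fm"
  | And "'r fm" "'r fm"
  | Ex nat "'r fm"

primrec fv :: "'r fm \<Rightarrow> nat set" where
  "fv (Eq i j) = {i, j}"
| "fv (Rel R is) = set is"
| "fv (Neg \<phi>) = fv \<phi>"
| "fv (And \<phi> \<psi>) = fv \<phi> \<union> fv \<psi>"
| "fv (Ex i \<phi>) = fv \<phi> - {i}"

primrec wf_fm :: "'r vocab \<Rightarrow> 'r fm \<Rightarrow> bool" where
  "wf_fm V (Eq i j) \<longleftrightarrow> True"
| "wf_fm V (Rel R is) \<longleftrightarrow> R \<in> syms V \<and> length is = arity V R"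
| "wf_fm V (Neg \<phi>) \<longleftrightarrow> wf_fm V \<phi>"
| "wf_fm V (And \<phi> \<psi>) \<longleftrightarrow> wf_fm V \<phi> \<and> wf_fm V \<psi>"
| "wf_fm V (Ex i \<phi>) \<longleftrightarrow> wf_fm V \<phi>"

primrec sat :: "('r, 'a) struct \<Rightarrow> 'r fm \<Rightarrow> (nat \<Rightarrow> 'a) \<Rightarrow> bool" where
  "sat M (Eq i j) e \<longleftrightarrow> e i = e j"
| "sat M (Rel R is) e \<longleftrightarrow> map e is \<in> rel M R"
| "sat M (Neg \<phi>) e \<longleftrightarrow> \<not> sat M \<phi> e"
| "sat M (And \<phi> \<psi>) e \<longleftrightarrow> sat M \<phi> e \<and> sat M \<psi> e"
| "sat M (Ex i \<phi>) e \<longleftrightarrow> (\<exists>a\<in>univ M. sat M \<phi> (e(i := a)))"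

text \<open>\<open>fmls V n\<close>: the formulas in the free variables \<open>0, \<dots>, n - 1\<close>.  They are evaluated at
  \<open>n\<close>-tuples, given as lists (the values of \<open>xs ! i\<close> for \<open>i \<ge> length xs\<close> do not matter).
  A formula \<open>\<phi>(x, b)\<close> in the \<open>n\<close> variables \<open>x\<close> with parameter tuple \<open>b\<close> is represented by a
  pair \<open>(\<phi>, b)\<close> with \<open>\<phi> \<in> fmls V (n + length b)\<close>.\<close>

definition fmls :: "'r vocab \<Rightarrow> nat \<Rightarrow> 'r fm set" where
  "fmls V n = {\<phi>. wf_fm V \<phi> \<and> fv \<phi> \<subseteq> {..<n}}"

definition holds :: "('r, 'a) struct \<Rightarrow> 'r fm \<Rightarrow> 'a list \<Rightarrow> bool" where
  "holds M \<phi> xs \<longleftrightarrow> sat M \<phi> (\<lambda>i. xs ! i)"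

definition tuples :: "('r, 'a) struct \<Rightarrow> nat \<Rightarrow> 'a list set" where
  "tuples M n = {xs \<in> lists (univ M). length xs = n}"

definition Th :: "'r vocab \<Rightarrow> ('r, 'a) struct \<Rightarrow> 'r fm set" where
  "Th V M = {\<phi> \<in> fmls V 0. holds M \<phi> []}"

definition is_model :: "'r vocab \<Rightarrow> 'r fm set \<Rightarrow> ('r, 'a) struct \<Rightarrow> bool" where
  "is_model V T N \<longleftrightarrow> is_struct V N \<and> (\<forall>\<phi>\<in>T. holds N \<phi> [])"

definition elem_emb ::
  "'r vocab \<Rightarrow> ('r, 'a) struct \<Rightarrow> ('r, 'b) struct \<Rightarrow> ('a \<Rightarrow> 'b) \<Rightarrow> bool" where
  "elem_emb V N N' f \<longleftrightarrow> is_struct V N' \<and> f ` univ N \<subseteq> univ N' \<and>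
     (\<forall>xs\<in>lists (univ N). \<forall>\<phi>\<in>fmls V (length xs). holds N \<phi> xs \<longleftrightarrow> holds N' \<phi> (map f xs))"

definition tp :: "'r vocab \<Rightarrow> ('r, 'a) struct \<Rightarrow> 'a list \<Rightarrow> 'a set \<Rightarrow> ('r fm \<times> 'a list) set" where
  "tp V N b A =
     {(\<phi>, as). as \<in> lists A \<and> \<phi> \<in> fmls V (length b + length as) \<and> holds N \<phi> (b @ as)}"

definition acl :: "'r vocab \<Rightarrow> ('r, 'a) struct \<Rightarrow> 'a set \<Rightarrow> 'a set" where
  "acl V M A = {b \<in> univ M. \<exists>as\<in>lists A. \<exists>\<phi>\<in>fmls V (1 + length as).
     holds M \<phi> (b # as) \<and> finite {c \<in> univ M. holds M \<phi> (c # as)}}"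

text \<open>The set \<open>A\<close> has to be taken nonempty: otherwise triviality would include
  \<open>acl(\<emptyset>) = \<emptyset>\<close>, which fails for an infinite set with one distinguished singleton
  predicate.  For nonempty \<open>A\<close>, elements of \<open>acl(\<emptyset>)\<close> are harmless.\<close>

definition acl_trivial :: "'r vocab \<Rightarrow> ('r, 'a) struct \<Rightarrow> bool" where
  "acl_trivial V M \<longleftrightarrow>
     (\<forall>A b. A \<subseteq> univ M \<and> A \<noteq> {} \<and> b \<in> univ M \<and> b \<in> acl V M A \<longrightarrow> (\<exists>a\<in>A. b \<in> acl V M {a}))"


section \<open>Dividing, forking, simplicity, supersimplicity and SU-rank\<close>

text \<open>Instead of working in a monster model, we pass to elementary extensions, presented as
  elementary embeddings \<open>f : N \<rightarrow> N'\<close>, where a monster would supply new elements.  All models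
  have their universe in the type \<^typ>\<open>'a\<close> of the given structure.  As vocabularies are finite,
  this is no restriction: if a model is infinite then so is \<^typ>\<open>'a\<close>, and each of the
  configurations below can, by downward Loewenheim-Skolem, be found in models with universe
  in \<^typ>\<open>'a\<close>; if it is finite then it has no proper elementary extension.\<close>

definition consistent :: "('r, 'a) struct \<Rightarrow> nat \<Rightarrow> ('r fm \<times> 'a list) set \<Rightarrow> bool" where
  "consistent N n \<Phi> \<longleftrightarrow>
     (\<forall>\<Phi>0. finite \<Phi>0 \<and> \<Phi>0 \<subseteq> \<Phi> \<longrightarrow>
        (\<exists>x\<in>tuples N n. \<forall>(\<phi>, b)\<in>\<Phi>0. holds N \<phi> (x @ b)))"

text \<open>The family \<open>\<phi>(x, bs 0), \<phi>(x, bs 1), \<dots>\<close> is \<open>k\<close>-inconsistent; \<open>x\<close> is an \<open>n\<close>-tuple.\<close>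

definition k_inconsistent ::
  "('r, 'a) struct \<Rightarrow> nat \<Rightarrow> nat \<Rightarrow> 'r fm \<Rightarrow> (nat \<Rightarrow> 'a list) \<Rightarrow> bool" where
  "k_inconsistent N k n \<phi> bs \<longleftrightarrow>
     (\<forall>I. finite I \<and> card I = k \<longrightarrow> \<not> consistent N n ((\<lambda>i. (\<phi>, bs i)) ` I))"

text \<open>\<open>divides V N A n \<phi> b\<close>: the formula \<open>\<phi>(x, b)\<close>, \<open>x\<close> an \<open>n\<close>-tuple, divides over \<open>A\<close>.
  The type of \<open>map f b\<close> over \<open>f ` A\<close> is the copy of the type of \<open>b\<close> over \<open>A\<close>.\<close>

definition divides ::
  "'r vocab \<Rightarrow> ('r, 'a) struct \<Rightarrow> 'a set \<Rightarrow> nat \<Rightarrow> 'r fm \<Rightarrow> 'a list \<Rightarrow> bool" where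
  "divides V N A n \<phi> b \<longleftrightarrow>
     (\<exists>(N' :: ('r, 'a) struct) f bs k. elem_emb V N N' f \<and> 1 \<le> k \<and>
        (\<forall>i. bs i \<in> tuples N' (length b) \<and>
             tp V N' (bs i) (f ` A) = tp V N' (map f b) (f ` A)) \<and>
        k_inconsistent N' k n \<phi> bs)"

definition forks ::
  "'r vocab \<Rightarrow> ('r, 'a) struct \<Rightarrow> 'a set \<Rightarrow> nat \<Rightarrow> 'r fm \<Rightarrow> 'a list \<Rightarrow> bool" where
  "forks V N A n \<phi> b \<longleftrightarrow>
     (\<exists>(N' :: ('r, 'a) struct) f \<Psi>. elem_emb V N N' f \<and> finite \<Psi> \<and>
        (\<forall>(\<psi>, c)\<in>\<Psi>. c \<in> lists (univ N') \<and> \<psi> \<in> fmls V (n + length c) \<and>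
             divides V N' (f ` A) n \<psi> c) \<and>
        (\<forall>x\<in>tuples N' n. holds N' \<phi> (x @ map f b) \<longrightarrow> (\<exists>(\<psi>, c)\<in>\<Psi>. holds N' \<psi> (x @ c))))"

text \<open>\<open>tp(b/B)\<close> forks over \<open>A\<close>.\<close>

definition tp_forks ::
  "'r vocab \<Rightarrow> ('r, 'a) struct \<Rightarrow> 'a list \<Rightarrow> 'a set \<Rightarrow> 'a set \<Rightarrow> bool" where
  "tp_forks V N b B A \<longleftrightarrow> (\<exists>(\<phi>, d)\<in>tp V N b B. forks V N A (length b) \<phi> d)"

text \<open>The formula \<open>\<phi>(x, y)\<close>, with \<open>x\<close> an \<open>n\<close>-tuple and \<open>y\<close> an \<open>m\<close>-tuple, has the tree property
  with respect to \<open>k\<close> in \<open>N\<close>.  The nodes of the tree are the finite sequences of naturals; the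
  nodes on the branch \<open>\<eta>\<close> are its initial segments.\<close>

definition tree_property ::
  "('r, 'a) struct \<Rightarrow> nat \<Rightarrow> nat \<Rightarrow> nat \<Rightarrow> 'r fm \<Rightarrow> bool" where
  "tree_property N k n m \<phi> \<longleftrightarrow>
     (\<exists>a :: nat list \<Rightarrow> 'a list. (\<forall>s. a s \<in> tuples N m) \<and>
        (\<forall>\<eta> :: nat \<Rightarrow> nat. consistent N n (range (\<lambda>j. (\<phi>, a (map \<eta> [0..<j]))))) \<and>
        (\<forall>s. k_inconsistent N k n \<phi> (\<lambda>i. a (s @ [i]))))"

definition simple :: "'r vocab \<Rightarrow> ('r, 'a) struct \<Rightarrow> bool" where
  "simple V M \<longleftrightarrow>
     \<not> (\<exists>(N :: ('r, 'a) struct) k n m. \<exists>\<phi>\<in>fmls V (n + m).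
          is_model V (Th V M) N \<and> 1 \<le> k \<and> tree_property N k n m \<phi>)"

definition supersimple :: "'r vocab \<Rightarrow> ('r, 'a) struct \<Rightarrow> bool" where
  "supersimple V M \<longleftrightarrow> simple V M \<and>
     (\<forall>(N :: ('r, 'a) struct) b A. is_model V (Th V M) N \<and> b \<in> lists (univ N) \<and> A \<subseteq> univ N \<longrightarrow>
        (\<exists>A0\<subseteq>A. finite A0 \<and> \<not> tp_forks V N b A A0))"

text \<open>\<open>SU_ge V n N b A\<close>: the SU-rank of \<open>tp(b/A)\<close> is at least \<open>n\<close>, that is, \<open>n = 0\<close> or some
  forking extension \<open>tp(b'/B)\<close> of it has SU-rank at least \<open>n - 1\<close>.\<close>

primrec SU_ge :: "'r vocab \<Rightarrow> nat \<Rightarrow> ('r, 'a) struct \<Rightarrow> 'a list \<Rightarrow> 'a set \<Rightarrow> bool" where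
  "SU_ge V 0 N b A \<longleftrightarrow> True"
| "SU_ge V (Suc n) N b A \<longleftrightarrow>
     (\<exists>(N' :: ('r, 'a) struct) f b' B. elem_emb V N N' f \<and>
        b' \<in> tuples N' (length b) \<and> f ` A \<subseteq> B \<and> B \<subseteq> univ N' \<and>
        tp V N' b' (f ` A) = tp V N' (map f b) (f ` A) \<and>
        tp_forks V N' b' B (f ` A) \<and> SU_ge V n N' b' B)"

text \<open>Only finite values of the SU-rank are distinguished: \<open>\<infinity>\<close> stands for every infinite ordinal
  as well as for an undefined rank.\<close>

definition SU :: "'r vocab \<Rightarrow> ('r, 'a) struct \<Rightarrow> 'a list \<Rightarrow> 'a set \<Rightarrow> enat" where
  "SU V N b A = Sup {enat n | n. SU_ge V n N b A}"

text \<open>The SU-rank of (the theory of) \<open>M\<close> is the supremum of the SU-ranks of complete 1-types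
  over \<open>\<emptyset>\<close>.\<close>

definition SU_rank :: "'r vocab \<Rightarrow> ('r, 'a) struct \<Rightarrow> enat" where
  "SU_rank V M =
     Sup {SU V N [a] {} | (N :: ('r, 'a) struct) a. is_model V (Th V M) N \<and> a \<in> univ N}"

end

theory Submission
  imports Defs "HOL-Library.Ramsey"
begin

text \<open>In a structure of SU-rank 1 no formula with infinitely many solutions divides over the empty set.
  This gives the exchange property of algebraic closure, so there are circuits (minimal dependent
  sets).  If closure is not trivial, there is a circuit with at least three elements, and gluing two
  copies of a circuit at a point, otherwise in general position, gives a larger one.  Let
  \<open>B \<union> {b, e}\<close> be a very large circuit and \<open>u\<^sub>0, u\<^sub>1, \<dots>\<close> an indiscernible sequence of conjugates of \<open>e\<close> over
  \<open>B\<close>.  Only boundedly many of the \<open>u\<^sub>i\<close> can be related to a common \<open>x\<close> over \<open>B\<close> as \<open>e\<close> is to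
  \<open>b\<close>.  Over a proper subset \<open>A\<close> of \<open>B\<close>, however, the type of \<open>b\<close> over \<open>A\<close> and \<open>e\<close> is not algebraic, hence does not
  divide, so arbitrarily many of the \<open>u\<^sub>i\<close> admit such an \<open>x\<close>, and by Ramsey the type of \<open>(x, u\<^sub>i, u\<^sub>j)\<close>
  for \<open>i < j\<close> may be taken constant.  As there are only finitely many ternary types, one and the same
  constant value works for all small \<open>A\<close>.  Since types are determined by their restrictions to
  triples, this describes a structure on \<open>x\<close>, \<open>B\<close> and many \<open>u\<^sub>i\<close> that is forbidden although all of its
  small substructures are permitted; it contains a large constraint.\<close>

section \<open>Automorphisms and types\<close>

lemma embedding_relD:
  "embedding V A B f \<Longrightarrow> R \<in> syms V \<Longrightarrow> xs \<in> lists (univ A) \<Longrightarrow> map f xs \<in> rel B R \<longleftrightarrow> xs \<in> rel A R"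
  by (simp add: embedding_def)

lemma embedding_comp:
  assumes "embedding V A B f" "embedding V B C g"
  shows "embedding V A C (g \<circ> f)"
  unfolding embedding_def
proof (intro conjI ballI)
  show "inj_on (g \<circ> f) (univ A)"
    using assms by (auto simp: embedding_def intro: comp_inj_on inj_on_subset)
  show "(g \<circ> f) ` univ A \<subseteq> univ C"
    using assms by (fastforce simp: embedding_def)
  fix R xs assume R: "R \<in> syms V" and xs: "xs \<in> lists (univ A)"
  have "map f xs \<in> lists (univ B)"
    using xs assms(1) by (fastforce simp: embedding_def)
  then show "(xs \<in> rel A R) = (map (g \<circ> f) xs \<in> rel C R)"
    using embedding_relD[OF assms(1) R xs] embedding_relD[OF assms(2) R, of "map f xs"] by simp
qed

lemma iso_comp: "iso V A B f \<Longrightarrow> iso V B C g \<Longrightarrow> iso V A C (g \<circ> f)"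
  unfolding iso_def using embedding_comp by (metis image_comp)

lemma iso_inv_into:
  assumes "iso V A B f"
  shows "iso V B A (inv_into (univ A) f)"
proof -
  let ?g = "inv_into (univ A) f"
  have inj: "inj_on f (univ A)" and im: "f ` univ A = univ B"
    using assms by (auto simp: iso_def embedding_def)
  have g: "?g ` univ B = univ A"
    using inj im by (metis inv_into_image_cancel subset_refl)
  have "(xs \<in> rel B R) = (map ?g xs \<in> rel A R)" if "R \<in> syms V" "xs \<in> lists (univ B)" for R xs
  proof -
    have "map ?g xs \<in> lists (univ A)" using that g by fastforce
    moreover have "map f (map ?g xs) = xs"
      unfolding map_map by (rule map_idI) (use that im in \<open>auto simp: in_lists_conv_set f_inv_into_f\<close>)
    ultimately show ?thesis
      using embedding_relD[of V A B f R "map ?g xs"] assms that by (simp add: iso_def)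
  qed
  then show ?thesis
    unfolding iso_def embedding_def using g im by (simp add: inj_on_inv_into)
qed

section \<open>Formulas and quantifier-free types\<close>

lemma sat_cong: "(\<And>i. i \<in> fv \<phi> \<Longrightarrow> e i = e' i) \<Longrightarrow> sat M \<phi> e = sat M \<phi> e'"
proof (induction \<phi> arbitrary: e e')
  case (Rel R "is")
  then have "map e is = map e' is" by auto
  then show ?case by (simp del: map_eq_conv)
next
  case (And \<phi> \<psi>)
  then show ?case by (metis Un_iff fv.simps(4) sat.simps(4))
next
  case (Ex i \<phi>)
  have "sat M \<phi> (e(i := a)) = sat M \<phi> (e'(i := a))" for a
    by (rule Ex.IH) (use Ex.prems in auto)
  then show ?case by simp
next
  case (Neg \<phi>)
  then show ?case by (metis fv.simps(3) sat.simps(3))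
qed simp

lemma fmls_conj:
  assumes "is_struct V M" "finite S" "S \<subseteq> fmls V n"
  shows "\<exists>\<phi>\<in>fmls V n. \<forall>e. sat M \<phi> e \<longleftrightarrow> (\<forall>\<psi>\<in>S. sat M \<psi> e)"
  using assms(2,3)
proof (induction S)
  case empty
  show ?case
    \<comment> \<open>Truth has to be expressed by a sentence, so that it lies in
      \<open>fmls V 0\<close> too; this one holds because the universe is nonempty.\<close>
    by (rule bexI[of _ "Ex 0 (Eq 0 0)"]) (use assms(1) in \<open>auto simp: fmls_def is_struct_def\<close>)
next
  case (insert \<psi> S)
  then obtain \<phi> where "\<phi> \<in> fmls V n" "\<forall>e. sat M \<phi> e \<longleftrightarrow> (\<forall>\<psi>\<in>S. sat M \<psi> e)" by auto
  with insert.prems show ?case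
    by (intro bexI[of _ "And \<psi> \<phi>"]) (auto simp: fmls_def)
qed

definition atoms :: "'r vocab \<Rightarrow> nat \<Rightarrow> 'r fm set" where
  "atoms V n = (\<lambda>(i, j). Eq i j) ` ({..<n} \<times> {..<n}) \<union>
     (\<Union>R\<in>syms V. Rel R ` {ws \<in> lists {..<n}. length ws = arity V R})"

lemma finite_atoms: "finite_relational V \<Longrightarrow> finite (atoms V n)"
  unfolding atoms_def finite_relational_def
  by (auto simp: finite_lists_length_eq lists_eq_set)

lemma atoms_fmls: "atoms V n \<subseteq> fmls V n"
  by (auto simp: atoms_def fmls_def)

text \<open>Recording the true atomic formulas is enough: for tuples of equal length, equal sets
  mean equal quantifier-free types, repetitions among the entries included.\<close>

definition qftp :: "'r vocab \<Rightarrow> ('r, 'a) struct \<Rightarrow> 'a list \<Rightarrow> 'r fm set" where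
  "qftp V M xs = {\<psi> \<in> atoms V (length xs). holds M \<psi> xs}"

section \<open>Automorphisms, stabilisers and orbits\<close>

locale homogeneous_struct =
  fixes V :: "'r vocab" and M :: "('r, 'a) struct"
  assumes homogeneous: "homogeneous V M"
begin

abbreviation U :: "'a set" where "U \<equiv> univ M"

definition Aut :: "('a \<Rightarrow> 'a) set" where "Aut = {g. iso V M M g}"

definition stab :: "'a set \<Rightarrow> ('a \<Rightarrow> 'a) set" where "stab A = {g \<in> Aut. \<forall>a\<in>A. g a = a}"

text \<open>For a finite set \<open>A\<close> and a point \<open>b\<close> of the universe this is,
  by homogeneity, the set of realisations in \<open>M\<close> of the type of \<open>b\<close> over
  \<open>A\<close>.\<close>

definition orb :: "'a set \<Rightarrow> 'a \<Rightarrow> 'a set" where "orb A b = (\<lambda>g. g b) ` stab A"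

lemma struct: "is_struct V M" and fin_rel: "finite_relational V"
  using homogeneous by (auto simp: homogeneous_def)

lemma Aut_bij: "g \<in> Aut \<Longrightarrow> bij_betw g U U"
  by (auto simp: Aut_def iso_def embedding_def bij_betw_def)

lemma Aut_in: "g \<in> Aut \<Longrightarrow> x \<in> U \<Longrightarrow> g x \<in> U"
  using Aut_bij by (meson bij_betwE)

lemma Aut_eq_iff: "g \<in> Aut \<Longrightarrow> x \<in> U \<Longrightarrow> y \<in> U \<Longrightarrow> g x = g y \<longleftrightarrow> x = y"
  using Aut_bij by (meson bij_betw_imp_inj_on inj_on_eq_iff)

lemma Aut_inj_on: "g \<in> Aut \<Longrightarrow> A \<subseteq> U \<Longrightarrow> inj_on g A"
  using Aut_bij by (meson bij_betw_imp_inj_on inj_on_subset)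

lemma Aut_rel: "g \<in> Aut \<Longrightarrow> R \<in> syms V \<Longrightarrow> set xs \<subseteq> U \<Longrightarrow> map g xs \<in> rel M R \<longleftrightarrow> xs \<in> rel M R"
  using embedding_relD[of V M M g R xs] by (auto simp: Aut_def iso_def)

lemma id_Aut: "id \<in> Aut"
  by (auto simp: Aut_def iso_def embedding_def)

lemma Aut_comp: "g \<in> Aut \<Longrightarrow> h \<in> Aut \<Longrightarrow> h \<circ> g \<in> Aut"
  unfolding Aut_def using iso_comp by blast

lemma Aut_inv:
  assumes "g \<in> Aut"
  obtains h where "h \<in> Aut" "\<And>x. x \<in> U \<Longrightarrow> h (g x) = x" "\<And>x. x \<in> U \<Longrightarrow> g (h x) = x"
proof
  let ?h = "inv_into U g"
  show "?h \<in> Aut" using assms iso_inv_into by (auto simp: Aut_def)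
  show "?h (g x) = x" if "x \<in> U" for x
    using that Aut_bij[OF assms] by (simp add: bij_betw_inv_into_left)
  show "g (?h x) = x" if "x \<in> U" for x
    using that Aut_bij[OF assms] by (simp add: bij_betw_inv_into_right)
qed

lemma stab_Aut: "g \<in> stab A \<Longrightarrow> g \<in> Aut" and stab_fix: "g \<in> stab A \<Longrightarrow> a \<in> A \<Longrightarrow> g a = a"
  by (auto simp: stab_def)

lemma stab_comp: "g \<in> stab A \<Longrightarrow> h \<in> stab A \<Longrightarrow> h \<circ> g \<in> stab A"
  by (auto simp: stab_def Aut_comp)

lemma stab_mono: "A \<subseteq> B \<Longrightarrow> stab B \<subseteq> stab A"
  by (auto simp: stab_def)

lemma stab_inv:
  assumes "g \<in> stab A" "A \<subseteq> U"
  obtains h where "h \<in> stab A" "\<And>x. x \<in> U \<Longrightarrow> h (g x) = x" "\<And>x. x \<in> U \<Longrightarrow> g (h x) = x"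
proof -
  obtain h where h: "h \<in> Aut" "\<And>x. x \<in> U \<Longrightarrow> h (g x) = x" "\<And>x. x \<in> U \<Longrightarrow> g (h x) = x"
    using Aut_inv stab_Aut[OF assms(1)] by blast
  moreover have "h a = a" if "a \<in> A" for a
    using h(2)[of a] that assms by (auto simp: stab_fix)
  ultimately have "h \<in> stab A" by (simp add: stab_def)
  then show ?thesis using that h by blast
qed

lemma stab_map: "g \<in> Aut \<Longrightarrow> map g as = as \<Longrightarrow> g \<in> stab (set as)"
  by (simp add: stab_def) (metis list.map_id map_eq_conv id_apply)

lemma orbI: "g \<in> stab A \<Longrightarrow> g b \<in> orb A b"
  by (auto simp: orb_def)

lemma orb_mono: "A \<subseteq> B \<Longrightarrow> orb B b \<subseteq> orb A b"
  unfolding orb_def by (intro image_mono stab_mono)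

lemma orb_subset: "b \<in> U \<Longrightarrow> orb A b \<subseteq> U"
  by (auto simp: orb_def stab_def Aut_in)

text \<open>Homogeneity in the form used below, for a map between finite sets instead of an
  isomorphism of substructures. The empty set is treated separately because it carries no
  substructure.\<close>

lemma extend_partial:
  assumes "finite A" "A \<subseteq> U" "inj_on f A" "f ` A \<subseteq> U"
    and rel: "\<And>R xs. R \<in> syms V \<Longrightarrow> xs \<in> lists A \<Longrightarrow> length xs = arity V R \<Longrightarrow>
      xs \<in> rel M R \<longleftrightarrow> map f xs \<in> rel M R"
  shows "\<exists>g\<in>Aut. \<forall>x\<in>A. g x = f x"
proof (cases "A = {}")
  case True
  then show ?thesis using id_Aut by blast
next
  case False
  let ?A = "\<lparr>univ = A, rel = \<lambda>R. rel M R \<inter> lists A\<rparr>"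
  let ?B = "\<lparr>univ = f ` A, rel = \<lambda>R. rel M R \<inter> lists (f ` A)\<rparr>"
  have len: "length xs = arity V R" if "R \<in> syms V" "xs \<in> rel M R" for R xs
    using that struct by (auto simp: is_struct_def)
  have "substruct V ?A M" "substruct V ?B M"
    using False assms len by (auto simp: substruct_def is_struct_def)
  moreover have "iso V ?A ?B f"
    unfolding iso_def embedding_def
  proof (intro conjI ballI)
    fix R xs assume "R \<in> syms V" "xs \<in> lists (univ ?A)"
    then show "(xs \<in> rel ?A R) = (map f xs \<in> rel ?B R)"
      using rel[of R xs] len[of R xs] len[of R "map f xs"] by (auto simp: in_lists_conv_set)
  qed (use assms in auto)
  ultimately have "\<exists>g. iso V M M g \<and> (\<forall>x\<in>univ ?A. g x = f x)"
    using homogeneous assms(1) unfolding homogeneous_def by (metis finite_imageI select_convs(1))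
  then show ?thesis by (auto simp: Aut_def)
qed

section \<open>Invariance and isolation of types\<close>

lemma sat_Aut:
  assumes g: "g \<in> Aut"
  shows "wf_fm V \<phi> \<Longrightarrow> (\<And>i. i \<in> fv \<phi> \<Longrightarrow> e i \<in> U) \<Longrightarrow> sat M \<phi> (g \<circ> e) \<longleftrightarrow> sat M \<phi> e"
proof (induction \<phi> arbitrary: e)
  case (Eq i j)
  then show ?case using Aut_eq_iff[OF g] by auto
next
  case (Rel R "is")
  then show ?case using Aut_rel[OF g, of R "map e is"] by (auto simp: o_def)
next
  case (And \<phi> \<psi>)
  then show ?case by (metis UnCI fv.simps(4) sat.simps(4) wf_fm.simps(4))
next
  case (Ex i \<phi>)
  have upd: "sat M \<phi> ((g \<circ> e)(i := g a)) = sat M \<phi> (e(i := a))" if "a \<in> U" for a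
  proof -
    have "(g \<circ> e)(i := g a) = g \<circ> (e(i := a))" by auto
    moreover have "sat M \<phi> (g \<circ> (e(i := a))) = sat M \<phi> (e(i := a))"
      by (rule Ex.IH) (use Ex.prems that in auto)
    ultimately show ?thesis by simp
  qed
  have "g ` U = U" using Aut_bij[OF g] by (simp add: bij_betw_def)
  then have "sat M (Ex i \<phi>) (g \<circ> e) \<longleftrightarrow> (\<exists>a\<in>U. sat M \<phi> ((g \<circ> e)(i := g a)))"
    using bex_simps(7)[of g U "\<lambda>a. sat M \<phi> ((g \<circ> e)(i := a))"] by (simp del: fun_upd_apply)
  then show ?case using upd by (simp del: fun_upd_apply comp_apply cong: bex_cong)
qed auto

lemma holds_Aut:
  assumes "g \<in> Aut" "\<phi> \<in> fmls V (length xs)" "set xs \<subseteq> U"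
  shows "holds M \<phi> (map g xs) \<longleftrightarrow> holds M \<phi> xs"
proof -
  have "holds M \<phi> (map g xs) \<longleftrightarrow> sat M \<phi> (g \<circ> (\<lambda>i. xs ! i))"
    unfolding holds_def by (rule sat_cong) (use assms in \<open>auto simp: fmls_def\<close>)
  also have "\<dots> \<longleftrightarrow> holds M \<phi> xs"
    unfolding holds_def by (rule sat_Aut) (use assms in \<open>auto simp: fmls_def subset_iff\<close>)
  finally show ?thesis .
qed

lemma tp_stab:
  assumes "g \<in> stab A" "A \<subseteq> U" "set b \<subseteq> U"
  shows "tp V M (map g b) A = tp V M b A"
proof -
  have "holds M \<phi> (map g b @ as) = holds M \<phi> (b @ as)"
    if "\<phi> \<in> fmls V (length b + length as)" "set as \<subseteq> A" for \<phi> as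
  proof -
    have "map g b @ as = map g (b @ as)"
      using that assms(1) by (auto simp: subset_iff stab_fix intro!: map_idI[symmetric])
    moreover have "holds M \<phi> (map g (b @ as)) = holds M \<phi> (b @ as)"
      by (rule holds_Aut) (use that assms stab_Aut in auto)
    ultimately show ?thesis by simp
  qed
  then show ?thesis
    by (intro set_eqI) (auto simp: tp_def in_lists_conv_set)
qed

lemma qftp_map: "g \<in> Aut \<Longrightarrow> set xs \<subseteq> U \<Longrightarrow> qftp V M (map g xs) = qftp V M xs"
  using holds_Aut atoms_fmls by (fastforce simp: qftp_def)

text \<open>By homogeneity the quantifier-free type determines the orbit: its equations make the map
  between corresponding entries well defined and injective, its relational formulas make it a
  partial isomorphism.\<close>

lemma qftp_eqD:
  assumes "length xs = length ys" "set xs \<subseteq> U" "set ys \<subseteq> U" "qftp V M xs = qftp V M ys"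
  shows "\<exists>g\<in>Aut. map g xs = ys"
proof -
  let ?n = "length xs"
  have same: "holds M \<psi> xs \<longleftrightarrow> holds M \<psi> ys" if "\<psi> \<in> atoms V ?n" for \<psi>
    using assms that by (auto simp: qftp_def)
  have eq: "xs ! i = xs ! j \<longleftrightarrow> ys ! i = ys ! j" if "i < ?n" "j < ?n" for i j
    using same[of "Eq i j"] that by (auto simp: atoms_def holds_def)
  \<comment> \<open>Entries may repeat, so some position is chosen for each; by \<open>eq\<close>
    the resulting map does not depend on the choice.\<close>
  define idx where "idx x = (SOME i. i < ?n \<and> xs ! i = x)" for x
  have idx: "idx x < ?n \<and> xs ! idx x = x" if "x \<in> set xs" for x
    unfolding idx_def by (rule someI_ex) (use that in \<open>auto simp: in_set_conv_nth\<close>)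
  define f where "f x = ys ! idx x" for x
  have f: "f (xs ! i) = ys ! i" if "i < ?n" for i
    unfolding f_def using eq[of "idx (xs ! i)" i] idx[of "xs ! i"] that by auto
  have "\<exists>g\<in>Aut. \<forall>x\<in>set xs. g x = f x"
  proof (rule extend_partial)
    show "inj_on f (set xs)"
      by (auto simp: inj_on_def in_set_conv_nth f eq)
    show "f ` set xs \<subseteq> U"
      using assms idx by (auto simp: f_def intro!: nth_mem[THEN subsetD[OF assms(3)]])
    fix R zs assume R: "R \<in> syms V" and zs: "zs \<in> lists (set xs)" and len: "length zs = arity V R"
    have "Rel R (map idx zs) \<in> atoms V ?n"
      unfolding atoms_def by (rule UnI2, rule UN_I[OF R], rule imageI) (use zs len idx in auto)
    moreover have "map ((!) xs) (map idx zs) = zs"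
      using zs idx by (auto simp: in_lists_conv_set intro!: map_idI)
    moreover have "map ((!) ys) (map idx zs) = map f zs"
      by (auto simp: f_def)
    ultimately show "zs \<in> rel M R \<longleftrightarrow> map f zs \<in> rel M R"
      using same[of "Rel R (map idx zs)"] unfolding holds_def sat.simps by metis
  qed (use assms in auto)
  then obtain g where g: "g \<in> Aut" "\<forall>x\<in>set xs. g x = f x" by blast
  have "map g xs = ys"
    by (rule nth_equalityI) (use g(2) f assms(1) in auto)
  then show ?thesis using g(1) by blast
qed

lemma finite_qftps: "finite ((\<lambda>xs. qftp V M xs) ` {xs. length xs = n})"
proof (rule finite_subset)
  show "(\<lambda>xs. qftp V M xs) ` {xs. length xs = n} \<subseteq> Pow (atoms V n)"
    by (auto simp: qftp_def)
  show "finite (Pow (atoms V n))"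
    using finite_atoms[OF fin_rel] by simp
qed

text \<open>There are only finitely many atomic formulas in the given variables. The conjunction of
  each of them or its negation, whichever is true of \<open>xs\<close>, fixes the quantifier-free
  type and hence the orbit.\<close>

lemma isolating:
  assumes "set xs \<subseteq> U"
  obtains \<phi> where "\<phi> \<in> fmls V (length xs)"
    "\<And>ys. set ys \<subseteq> U \<Longrightarrow> length ys = length xs \<Longrightarrow> holds M \<phi> ys \<longleftrightarrow> (\<exists>g\<in>Aut. map g xs = ys)"
proof -
  let ?n = "length xs"
  let ?S = "(\<lambda>\<psi>. if holds M \<psi> xs then \<psi> else Neg \<psi>) ` atoms V ?n"
  have S: "finite ?S" "?S \<subseteq> fmls V ?n"
    using finite_atoms[OF fin_rel] atoms_fmls[of V ?n] by (auto simp: fmls_def subset_iff)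
  obtain \<phi> where \<phi>: "\<phi> \<in> fmls V ?n" "\<forall>e. sat M \<phi> e \<longleftrightarrow> (\<forall>\<psi>\<in>?S. sat M \<psi> e)"
    using fmls_conj[OF struct S] by (elim bexE)
  have "holds M \<phi> ys \<longleftrightarrow> qftp V M xs = qftp V M ys" if "length ys = ?n" for ys
  proof -
    have "holds M \<phi> ys \<longleftrightarrow> (\<forall>\<psi>\<in>atoms V ?n. holds M \<psi> ys = holds M \<psi> xs)"
      unfolding holds_def \<phi>(2)[rule_format] ball_simps(9) by (intro ball_cong refl) simp
    then show ?thesis using that by (auto simp: qftp_def)
  qed
  moreover have "qftp V M xs = qftp V M ys \<longleftrightarrow> (\<exists>g\<in>Aut. map g xs = ys)"
    if "set ys \<subseteq> U" "length ys = ?n" for ys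
    using qftp_eqD[of xs ys] qftp_map[of _ xs] that assms by metis
  ultimately show ?thesis using \<phi>(1) by (intro that) auto
qed

text \<open>The orbit of \<open>b\<close> over the parameters of a formula true of \<open>b\<close>
  lies in the solution set; conversely, all solutions of the formula isolating the type of
  \<open>b\<close> over \<open>F\<close> lie in the orbit. A finite \<open>F\<close> enters because
  a formula has finitely many parameters.\<close>

lemma acl_iff_orb:
  assumes "A \<subseteq> U"
  shows "b \<in> acl V M A \<longleftrightarrow> b \<in> U \<and> (\<exists>F\<subseteq>A. finite F \<and> finite (orb F b))"
proof
  assume "b \<in> acl V M A"
  then obtain as \<phi> where b: "b \<in> U" and as: "set as \<subseteq> A" and \<phi>: "\<phi> \<in> fmls V (1 + length as)"
    "holds M \<phi> (b # as)" and fin: "finite {c \<in> U. holds M \<phi> (c # as)}"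
    by (auto simp: acl_def)
  have "orb (set as) b \<subseteq> {c \<in> U. holds M \<phi> (c # as)}"
  proof
    fix c assume "c \<in> orb (set as) b"
    then obtain g where g: "g \<in> stab (set as)" "c = g b" by (auto simp: orb_def)
    then have "map g (b # as) = c # as" by (auto simp: stab_fix map_idI)
    moreover have "holds M \<phi> (map g (b # as)) = holds M \<phi> (b # as)"
      by (rule holds_Aut) (use g \<phi>(1) b as assms stab_Aut in auto)
    ultimately show "c \<in> {c \<in> U. holds M \<phi> (c # as)}"
      using g \<phi>(2) b Aut_in stab_Aut by simp
  qed
  then show "b \<in> U \<and> (\<exists>F\<subseteq>A. finite F \<and> finite (orb F b))"
    using fin b as finite_subset by blast
next
  assume "b \<in> U \<and> (\<exists>F\<subseteq>A. finite F \<and> finite (orb F b))"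
  then obtain as where b: "b \<in> U" and as: "set as \<subseteq> A" and fin: "finite (orb (set as) b)"
    by (metis finite_list)
  have "set (b # as) \<subseteq> U" using b as assms by auto
  from isolating[OF this] obtain \<phi> where \<phi>: "\<phi> \<in> fmls V (length (b # as))"
    "\<And>ys. set ys \<subseteq> U \<Longrightarrow> length ys = length (b # as) \<Longrightarrow>
      holds M \<phi> ys \<longleftrightarrow> (\<exists>g\<in>Aut. map g (b # as) = ys)"
    by blast
  have "{c \<in> U. holds M \<phi> (c # as)} \<subseteq> orb (set as) b"
  proof
    fix c assume "c \<in> {c \<in> U. holds M \<phi> (c # as)}"
    then obtain g where "g \<in> Aut" "map g (b # as) = c # as"
      using \<phi>(2)[of "c # as"] as assms by auto
    then show "c \<in> orb (set as) b"
      using orbI[OF stab_map, of g as b] by simp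
  qed
  moreover have "holds M \<phi> (b # as)"
    using \<phi>(2)[OF \<open>set (b # as) \<subseteq> U\<close> refl] id_Aut by (metis list.map_id)
  ultimately show "b \<in> acl V M A"
    using b as \<phi>(1) finite_subset[OF _ fin] unfolding acl_def by (auto intro!: bexI[of _ as])
qed

text \<open>On finite sets this is algebraic closure; on infinite sets it is junk, since the orbit
  condition has no finite character there.\<close>

definition cl :: "'a set \<Rightarrow> 'a set" where "cl A = {b \<in> U. finite (orb A b)}"

lemma cl_mono: "A \<subseteq> B \<Longrightarrow> cl A \<subseteq> cl B"
  using finite_subset[OF orb_mono] by (auto simp: cl_def)

lemma cl_increasing: "A \<subseteq> U \<Longrightarrow> A \<subseteq> cl A"
proof
  fix a assume "A \<subseteq> U" "a \<in> A"
  moreover from this have "orb A a \<subseteq> {a}" by (auto simp: orb_def stab_fix)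
  ultimately show "a \<in> cl A" using finite_subset by (auto simp: cl_def)
qed

text \<open>Automorphisms over \<open>A\<close> can move \<open>C\<close> in only finitely many
  ways, and two that agree on \<open>C\<close> differ by one fixing \<open>A \<union> C\<close>. So
  the orbit of \<open>b\<close> over \<open>A\<close> is covered by finitely many translates of a
  finite orbit.\<close>

lemma cl_absorb:
  assumes A: "A \<subseteq> U" and C: "finite C" "C \<subseteq> cl A" and b: "b \<in> cl (A \<union> C)"
  shows "b \<in> cl A"
proof -
  let ?r = "\<lambda>g. restrict g C"
  have fin: "finite (?r ` stab A)"
  proof (rule finite_subset)
    show "?r ` stab A \<subseteq> PiE C (orb A)" by (auto simp: orb_def)
    show "finite (PiE C (orb A))" using C by (auto intro!: finite_PiE simp: cl_def)
  qed
  \<comment> \<open>A representative of the automorphisms over \<open>A\<close> with a given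
    restriction to \<open>C\<close>.\<close>
  define s where "s p = (SOME g. g \<in> stab A \<and> ?r g = p)" for p
  have s: "s (?r g) \<in> stab A \<and> ?r (s (?r g)) = ?r g" if "g \<in> stab A" for g
    unfolding s_def by (rule someI[of _ g]) (use that in auto)
  have bU: "b \<in> U" and CU: "C \<subseteq> U" using b C by (auto simp: cl_def)
  have "orb A b \<subseteq> (\<Union>p\<in>?r ` stab A. s p ` orb (A \<union> C) b)"
  proof
    fix x assume "x \<in> orb A b"
    then obtain g where g: "g \<in> stab A" "x = g b" by (auto simp: orb_def)
    let ?s = "s (?r g)"
    obtain h where h: "h \<in> stab A" "\<And>x. x \<in> U \<Longrightarrow> h (?s x) = x" "\<And>x. x \<in> U \<Longrightarrow> ?s (h x) = x"
      using stab_inv[of ?s A] s[OF g(1)] A by blast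
    have "?s c = g c" if "c \<in> C" for c
      using s[OF g(1)] that by (metis restrict_apply')
    then have "h (g c) = c" if "c \<in> C" for c
      using h(2)[of c] that CU by auto
    then have "h \<circ> g \<in> stab (A \<union> C)"
      using stab_comp[OF g(1) h(1)] by (auto simp: stab_def)
    then have "(h \<circ> g) b \<in> orb (A \<union> C) b" unfolding orb_def by blast
    moreover have "x = ?s ((h \<circ> g) b)"
      using h(3)[of "g b"] g bU Aut_in stab_Aut by auto
    ultimately show "x \<in> (\<Union>p\<in>?r ` stab A. s p ` orb (A \<union> C) b)"
      using g(1) by blast
  qed
  then have "finite (orb A b)"
    by (rule finite_subset) (intro finite_UN_I fin finite_imageI, use b in \<open>simp add: cl_def\<close>)
  then show ?thesis using bU by (auto simp: cl_def)
qed

lemma cl_trans: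
  assumes "A \<subseteq> U" "finite B" "B \<subseteq> cl A"
  shows "cl B \<subseteq> cl A"
  using cl_absorb[OF assms] cl_mono[of B "A \<union> B"] by blast

lemma cl_image:
  assumes g: "g \<in> Aut" and A: "A \<subseteq> U" and b: "b \<in> cl A"
  shows "g b \<in> cl (g ` A)"
proof -
  obtain h where h: "h \<in> Aut" "\<And>x. x \<in> U \<Longrightarrow> h (g x) = x" "\<And>x. x \<in> U \<Longrightarrow> g (h x) = x"
    using Aut_inv[OF g] by blast
  have bU: "b \<in> U" using b by (simp add: cl_def)
  have "orb (g ` A) (g b) \<subseteq> g ` orb A b"
  proof
    fix x assume "x \<in> orb (g ` A) (g b)"
    then obtain k where k: "k \<in> stab (g ` A)" "x = k (g b)" by (auto simp: orb_def)
    have "h \<circ> (k \<circ> g) \<in> stab A"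
      using k g h A by (auto simp: stab_def subset_iff intro!: Aut_comp)
    from orbI[OF this, of b] have "h (k (g b)) \<in> orb A b" by simp
    moreover have "x = g (h (k (g b)))"
      using h(3) k g bU Aut_in stab_Aut by auto
    ultimately show "x \<in> g ` orb A b" by (metis imageI)
  qed
  then have "finite (orb (g ` A) (g b))"
    by (rule finite_subset) (use b in \<open>simp add: cl_def\<close>)
  then show ?thesis
    using bU Aut_in[OF g] by (simp add: cl_def)
qed

lemma cl_image_iff:
  assumes g: "g \<in> Aut" and A: "A \<subseteq> U" and b: "b \<in> U"
  shows "g b \<in> cl (g ` A) \<longleftrightarrow> b \<in> cl A"
proof
  assume *: "g b \<in> cl (g ` A)"
  obtain h where h: "h \<in> Aut" "\<And>x. x \<in> U \<Longrightarrow> h (g x) = x"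
    using Aut_inv[OF g] by blast
  have "h ` g ` A = A" using h A by (force simp: image_iff)
  then show "b \<in> cl A"
    using cl_image[OF h(1) _ *] A b h Aut_in[OF g] by auto
qed (rule cl_image[OF g A])

text \<open>Finitely many types over \<open>A\<close> occur, and the points of the closure that
  share a type lie in one finite orbit.\<close>

lemma finite_cl:
  assumes "finite A" "A \<subseteq> U"
  shows "finite (cl A)"
proof -
  obtain as where as: "set as = A" using assms finite_list by blast
  let ?q = "\<lambda>b. qftp V M (b # as)"
  have "finite (?q ` cl A)"
    by (rule finite_subset[OF _ finite_qftps[of "Suc (length as)"]]) auto
  moreover have "finite {c \<in> cl A. ?q c = p}" if p: "p \<in> ?q ` cl A" for p
  proof -
    obtain b where b: "b \<in> cl A" "p = ?q b" using p by blast
    have "{c \<in> cl A. ?q c = p} \<subseteq> orb A b"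
    proof
      fix c assume c: "c \<in> {c \<in> cl A. ?q c = p}"
      then obtain g where "g \<in> Aut" "map g (b # as) = c # as"
        using qftp_eqD[of "b # as" "c # as"] b as assms by (auto simp: cl_def)
      then show "c \<in> orb A b"
        using as orbI[OF stab_map, of g as b] by simp
    qed
    then show ?thesis using b finite_subset by (auto simp: cl_def)
  qed
  ultimately have "finite (\<Union>p\<in>?q ` cl A. {c \<in> cl A. ?q c = p})" by blast
  then show ?thesis by (rule rev_finite_subset) auto
qed

text \<open>A single automorphism over \<open>A\<close> moving \<open>c\<close> back to
  \<open>b\<close> carries all of \<open>T\<close> into the orbit of \<open>e\<close> over
  \<open>A\<close> and \<open>b\<close>. This bounds how many conjugates of \<open>e\<close> can be
  related to a common point as \<open>e\<close> is to \<open>b\<close>; exchange and the final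
  contradiction both rest on it.\<close>

lemma finite_fibre_count:
  assumes A: "A \<subseteq> U" "b \<in> U" "e \<in> U" and fin: "finite (orb (insert b A) e)"
    and T: "\<And>t. t \<in> T \<Longrightarrow> \<exists>g\<in>stab A. g b = c \<and> g e = t"
  shows "finite T \<and> card T \<le> card (orb (insert b A) e)"
proof (cases "T = {}")
  case False
  then obtain g0 where g0: "g0 \<in> stab A" "g0 b = c" using T by auto
  obtain h where h: "h \<in> stab A" "\<And>x. x \<in> U \<Longrightarrow> h (g0 x) = x" "\<And>x. x \<in> U \<Longrightarrow> g0 (h x) = x"
    using stab_inv[OF g0(1) A(1)] by blast
  have "T \<subseteq> U" using T A(3) Aut_in stab_Aut by blast
  then have "inj_on h T" using Aut_inj_on h stab_Aut by blast
  moreover have "h ` T \<subseteq> orb (insert b A) e"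
  proof
    fix x assume "x \<in> h ` T"
    then obtain g where g: "g \<in> stab A" "g b = c" "x = h (g e)" using T by blast
    then have "h \<circ> g \<in> stab (insert b A)"
      using stab_comp[OF g(1) h(1)] h(2)[of b] g0 A by (auto simp: stab_def)
    from orbI[OF this, of e] show "x \<in> orb (insert b A) e" using g by simp
  qed
  ultimately show ?thesis using fin by (metis card_inj_on_le finite_imageD finite_subset)
qed simp

end

section \<open>Nondividing and the pregeometry of algebraic closure\<close>

lemma elem_emb_id: "is_struct V M \<Longrightarrow> elem_emb V M M id"
  by (simp add: elem_emb_def)

lemma forks_if_divides:
  assumes "is_struct V M" "A \<subseteq> univ M" "d \<in> lists (univ M)" "\<phi> \<in> fmls V (n + length d)"
    "divides V M A n \<phi> d"
  shows "forks V M A n \<phi> d"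
  unfolding forks_def
  by (rule exI[of _ M], rule exI[of _ id], rule exI[of _ "{(\<phi>, d)}"])
    (use assms elem_emb_id in auto)

section \<open>Dividing and lower bounds for the SU-rank\<close>

context homogeneous_struct
begin

text \<open>The model itself serves as the elementary extension: images of \<open>d\<close> under
  automorphisms over \<open>A\<close> keep its type over \<open>A\<close>, and inconsistency means
  that no tuple of \<open>M\<close> solves the formulas for \<open>k\<close> indices at
  once.\<close>

lemma divides_if_Aut_images:
  assumes "A \<subseteq> U" "set d \<subseteq> U" "\<And>i::nat. \<exists>g\<in>stab A. ds i = map g d" "1 \<le> k"
    "\<And>I x. finite I \<Longrightarrow> card I = k \<Longrightarrow> x \<in> tuples M n \<Longrightarrow> \<exists>i\<in>I. \<not> holds M \<phi> (x @ ds i)"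
  shows "divides V M A n \<phi> d"
proof -
  have "ds i \<in> tuples M (length d) \<and> tp V M (ds i) (id ` A) = tp V M (map id d) (id ` A)" for i
  proof -
    obtain g where g: "g \<in> stab A" "ds i = map g d" using assms(3) by blast
    then show ?thesis
      using tp_stab[OF g(1) assms(1,2)] assms(2) Aut_in[OF stab_Aut[OF g(1)]]
      by (auto simp: tuples_def subset_iff)
  qed
  moreover have "k_inconsistent M k n \<phi> ds"
    unfolding k_inconsistent_def consistent_def
  proof (intro allI impI notI)
    fix I :: "nat set"
    assume I: "finite I \<and> card I = k"
      and *: "\<forall>\<Phi>0. finite \<Phi>0 \<and> \<Phi>0 \<subseteq> (\<lambda>i. (\<phi>, ds i)) ` I \<longrightarrow>
        (\<exists>x\<in>tuples M n. \<forall>(\<phi>, b)\<in>\<Phi>0. holds M \<phi> (x @ b))"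
    obtain x where "x \<in> tuples M n" "\<forall>(\<phi>, b)\<in>(\<lambda>i. (\<phi>, ds i)) ` I. holds M \<phi> (x @ b)"
      using *[rule_format, of "(\<lambda>i. (\<phi>, ds i)) ` I"] I by blast
    then show False using assms(5)[of I x] I by auto
  qed
  ultimately show ?thesis
    unfolding divides_def using elem_emb_id[OF struct] assms(4) by blast
qed

text \<open>A dividing type of \<open>c\<close> over \<open>a\<close> that is not algebraic can be forked once more, by naming \<open>c\<close>
  itself.\<close>

lemma SU_ge_2_if_divides:
  assumes a: "set a \<subseteq> U" and c: "c \<in> U" and inf: "infinite (orb (set a) c)"
    and as: "\<And>i::nat. \<exists>g\<in>Aut. as i = map g a" and K: "1 \<le> K"
    and no: "\<And>I c'. finite I \<Longrightarrow> card I = K \<Longrightarrow> c' \<in> U \<Longrightarrow>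
      \<exists>i\<in>I. \<forall>g\<in>Aut. \<not> (g c = c' \<and> map g a = as i)"
  shows "SU_ge V 2 M [c] {}"
proof -
  have ca: "set (c # a) \<subseteq> U" using a c by simp
  from isolating[OF this] obtain \<phi> where \<phi>: "\<phi> \<in> fmls V (length (c # a))"
    "\<And>ys. set ys \<subseteq> U \<Longrightarrow> length ys = length (c # a) \<Longrightarrow>
      holds M \<phi> ys \<longleftrightarrow> (\<exists>g\<in>Aut. map g (c # a) = ys)"
    by blast
  have as_U: "set (as i) \<subseteq> U" "length (as i) = length a" for i
    using as[of i] a Aut_in by (auto simp: subset_iff)
  \<comment> \<open>\<open>\<phi>\<close> isolates the type of \<open>c\<close> over
    \<open>a\<close>; by \<open>no\<close>, its copies over \<open>K\<close> of the tuples
    \<open>as i\<close> never have a common solution.\<close>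
  have "divides V M {} 1 \<phi> a"
  proof (rule divides_if_Aut_images[OF _ a _ K])
    show "\<exists>g\<in>stab {}. as i = map g a" for i using as by (auto simp: stab_def)
    fix I :: "nat set" and x assume I: "finite I" "card I = K" and "x \<in> tuples M 1"
    then obtain c' where c': "x = [c']" "c' \<in> U"
      by (auto simp: tuples_def length_Suc_conv)
    obtain i where i: "i \<in> I" "\<forall>g\<in>Aut. \<not> (g c = c' \<and> map g a = as i)"
      using no[OF I c'(2)] by blast
    have "\<not> holds M \<phi> (c' # as i)"
      using \<phi>(2)[of "c' # as i"] i(2) as_U[of i] c'(2) by auto
    then show "\<exists>i\<in>I. \<not> holds M \<phi> (x @ as i)"
      using c' i(1) by auto
  qed simp
  then have "forks V M {} 1 \<phi> a"
    by (intro forks_if_divides struct) (use a \<phi>(1) in auto)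
  moreover have "holds M \<phi> (c # a)"
    using \<phi>(2)[OF ca refl] id_Aut by (metis list.map_id)
  ultimately have fork1: "tp_forks V M [c] (set a) {}"
    unfolding tp_forks_def using \<phi>(1) by (intro bexI[of _ "(\<phi>, a)"]) (auto simp: tp_def)
  obtain s :: "nat \<Rightarrow> 'a" where s: "inj s" "range s \<subseteq> orb (set a) c"
    using inf infinite_countable_subset by blast
  \<comment> \<open>The formula \<open>x = c\<close> divides over \<open>a\<close>: there are
    infinitely many conjugates of \<open>c\<close> over \<open>a\<close>, and no point equals two of
    them.\<close>
  have "divides V M (set a) 1 (Eq 0 1) [c]"
  proof (rule divides_if_Aut_images[OF a, of _ "\<lambda>i. [s i]" 2])
    show "\<exists>g\<in>stab (set a). [s i] = map g [c]" for i
      using s(2) unfolding orb_def by auto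
    fix I :: "nat set" and x assume I: "finite I" "card I = 2" and "x \<in> tuples M 1"
    then obtain c' where c': "x = [c']"
      by (auto simp: tuples_def length_Suc_conv)
    obtain i j where "I = {i, j}" "i \<noteq> j"
      using I(2) by (meson card_2_iff)
    moreover from this have "s i \<noteq> s j" using s(1) by (simp add: inj_eq)
    ultimately show "\<exists>i\<in>I. \<not> holds M (Eq 0 1) (x @ [s i])"
      using c' by (auto simp: holds_def)
  qed (use c in auto)
  then have "forks V M (set a) 1 (Eq 0 1) [c]"
    by (intro forks_if_divides struct) (use a c in \<open>auto simp: fmls_def\<close>)
  then have fork2: "tp_forks V M [c] (insert c (set a)) (set a)"
    unfolding tp_forks_def
    by (intro bexI[of _ "(Eq 0 1, [c])"]) (auto simp: tp_def fmls_def holds_def)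
  \<comment> \<open>Naming \<open>c\<close> forks over \<open>a\<close>, so the rank over
    \<open>a\<close> is at least 1; the type over \<open>a\<close> forks over the empty set, which
    adds another 1.\<close>
  have "SU_ge V (Suc 0) M [c] (set a)"
    unfolding SU_ge.simps
    by (rule exI[of _ M], rule exI[of _ id], rule exI[of _ "[c]"], rule exI[of _ "insert c (set a)"])
      (use fork2 elem_emb_id[OF struct] a c in \<open>auto simp: tuples_def\<close>)
  then have "SU_ge V (Suc (Suc 0)) M [c] {}"
    by (subst SU_ge.simps, intro exI[of _ M] exI[of _ id] exI[of _ "[c]"] exI[of _ "set a"])
      (use fork1 elem_emb_id[OF struct] a c in \<open>auto simp: tuples_def\<close>)
  then show ?thesis by (simp add: numeral_2_eq_2)
qed

lemma SU_rank_ge: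
  assumes "SU_ge V n M [c] {}" "c \<in> U"
  shows "enat n \<le> SU_rank V M"
proof -
  have "enat n \<le> SU V M [c] {}"
    unfolding SU_def using assms by (blast intro: Sup_upper)
  also have "\<dots> \<le> SU_rank V M"
    unfolding SU_rank_def
    by (rule Sup_upper) (use assms struct in \<open>auto simp: is_model_def Th_def\<close>)
  finally show ?thesis .
qed

end

text \<open>The locale assumption says that the formula isolating the type of \<open>c\<close> over \<open>a\<close> does not divide
  over the empty set when that type is not algebraic; nothing else about forking is needed.\<close>

locale rank_one_struct = homogeneous_struct V M
  for V :: "'r vocab" and M :: "('r, 'a) struct" +
  assumes nondividing: "\<And>a c as K. set a \<subseteq> U \<Longrightarrow> c \<in> U \<Longrightarrow> infinite (orb (set a) c) \<Longrightarrow>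
    (\<And>i::nat. \<exists>g\<in>Aut. as i = map g a) \<Longrightarrow> 1 \<le> K \<Longrightarrow>
    \<exists>I c'. finite I \<and> card I = K \<and> c' \<in> U \<and> (\<forall>i\<in>I. \<exists>g\<in>Aut. g c = c' \<and> map g a = as i)"

lemma rank_one_structI:
  assumes "homogeneous V M" "SU_rank V M \<le> 1"
  shows "rank_one_struct V M"
proof -
  interpret homogeneous_struct V M by unfold_locales fact
  show ?thesis
  proof unfold_locales
    fix a c as and K :: nat
    assume *: "set a \<subseteq> U" "c \<in> U" "infinite (orb (set a) c)" "\<And>i::nat. \<exists>g\<in>Aut. as i = map g a" "1 \<le> K"
    show "\<exists>I c'. finite I \<and> card I = K \<and> c' \<in> U \<and> (\<forall>i\<in>I. \<exists>g\<in>Aut. g c = c' \<and> map g a = as i)"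
    proof (rule ccontr)
      assume no: "\<not> ?thesis"
      have "SU_ge V 2 M [c] {}"
      proof (rule SU_ge_2_if_divides[OF *])
        fix I :: "nat set" and c' assume "finite I" "card I = K" "c' \<in> U"
        then show "\<exists>i\<in>I. \<forall>g\<in>Aut. \<not> (g c = c' \<and> map g a = as i)"
          using no by blast
      qed
      then have "enat 2 \<le> 1"
        using SU_rank_ge[of 2 c] *(2) assms(2) order_trans by blast
      then show False by (simp add: one_enat_def)
    qed
  qed
qed

section \<open>Exchange, independent sets and circuits\<close>

context rank_one_struct
begin

text \<open>Nondividing relative to \<open>B\<close>: an enumeration of \<open>B\<close> is appended
  to the parameter \<open>e\<close>. It is the same in all conjugates, so the automorphisms obtained
  fix \<open>B\<close> pointwise.\<close>

lemma nondividing_over: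
  assumes B: "finite B" "B \<subseteq> U" and be: "b \<in> U" "e \<in> U" "b \<notin> cl (insert e B)"
    and es: "\<And>i::nat. es i \<in> orb B e" and K: "1 \<le> K"
  obtains I c where "finite I" "card I = K" "\<And>i. i \<in> I \<Longrightarrow> \<exists>g\<in>stab B. g b = c \<and> g e = es i"
proof -
  obtain bs where bs: "set bs = B" using finite_list B by blast
  have "\<exists>g\<in>Aut. es i # bs = map g (e # bs)" for i
  proof -
    obtain g where "g \<in> stab B" "es i = g e" using es[of i] by (auto simp: orb_def)
    then show ?thesis using bs by (intro bexI[of _ g]) (auto simp: stab_def intro!: map_idI[symmetric])
  qed
  moreover have "infinite (orb (set (e # bs)) b)"
    using be bs by (simp add: cl_def)
  ultimately obtain I c where I: "finite I" "card I = K"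
    and c: "\<forall>i\<in>I. \<exists>g\<in>Aut. g b = c \<and> map g (e # bs) = es i # bs"
    using nondividing[of "e # bs" b "\<lambda>i. es i # bs" K] be B bs K by (metis insert_subset list.simps(15))
  have "\<exists>g\<in>stab B. g b = c \<and> g e = es i" if "i \<in> I" for i
    using c that stab_map[of _ bs] bs by fastforce
  with I that show ?thesis by blast
qed

text \<open>If \<open>b\<close> were not algebraic over \<open>A\<close> and \<open>e\<close>,
  nondividing would relate one point to arbitrarily many conjugates of \<open>e\<close> as
  \<open>b\<close> is related to \<open>e\<close>. Since \<open>e\<close> is algebraic over
  \<open>A\<close> and \<open>b\<close>, their number is bounded.\<close>

lemma exchange:
  assumes A: "finite A" "A \<subseteq> U" and b: "b \<in> U" and e: "e \<in> cl (insert b A)" "e \<notin> cl A"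
  shows "b \<in> cl (insert e A)"
proof (rule ccontr)
  assume nb: "b \<notin> cl (insert e A)"
  have eU: "e \<in> U" and fin: "finite (orb (insert b A) e)" and inf: "infinite (orb A e)"
    using e by (auto simp: cl_def)
  obtain es :: "nat \<Rightarrow> 'a" where es: "inj es" "range es \<subseteq> orb A e"
    using inf infinite_countable_subset by blast
  \<comment> \<open>One more than \<open>finite_fibre_count\<close> allows.\<close>
  let ?K = "Suc (card (orb (insert b A) e))"
  obtain I c where I: "finite I" "card I = ?K"
    and c: "\<And>i. i \<in> I \<Longrightarrow> \<exists>g\<in>stab A. g b = c \<and> g e = es i"
    by (rule nondividing_over[OF A b eU nb, of es ?K]) (use es(2) in auto)
  have "card (es ` I) \<le> card (orb (insert b A) e)"
    using finite_fibre_count[OF A(2) b eU fin, of "es ` I" c] c by blast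
  moreover have "card (es ` I) = ?K"
    using I(2) es(1) by (simp add: card_image inj_on_subset)
  ultimately show False by simp
qed

definition acl_indep :: "'a set \<Rightarrow> bool" where
  "acl_indep X \<longleftrightarrow> finite X \<and> X \<subseteq> U \<and> (\<forall>x\<in>X. x \<notin> cl (X - {x}))"

lemma indep_subset: "acl_indep X \<Longrightarrow> Y \<subseteq> X \<Longrightarrow> acl_indep Y"
  unfolding acl_indep_def using cl_mono[of "Y - {_}" "X - {_}"] by (blast intro: finite_subset)

text \<open>If adding \<open>x\<close> made an old point \<open>y\<close> dependent on the others,
  exchange would put \<open>x\<close> into the closure of \<open>X\<close>.\<close>

lemma indep_insert:
  assumes X: "acl_indep X" and x: "x \<in> U" "x \<notin> cl X"
  shows "acl_indep (insert x X)"
  unfolding acl_indep_def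
proof (intro conjI ballI)
  show "finite (insert x X)" "insert x X \<subseteq> U" using X x by (auto simp: acl_indep_def)
  have xX: "x \<notin> X" using X x cl_increasing[of X] by (auto simp: acl_indep_def)
  fix y assume y: "y \<in> insert x X"
  show "y \<notin> cl (insert x X - {y})"
  proof (cases "y = x")
    case True
    then show ?thesis using x xX by simp
  next
    case False
    then have yX: "y \<in> X" using y by simp
    have eq: "insert x X - {y} = insert x (X - {y})" "insert y (X - {y}) = X"
      using False yX by auto
    show ?thesis
      using exchange[of "X - {y}" x y] X x yX eq by (auto simp: acl_indep_def)
  qed
qed

text \<open>Steinitz replacement: a point of \<open>X\<close> outside \<open>S\<close> is traded for
  a point of \<open>S\<close>. Independence and size are kept, while \<open>X - S\<close>
  shrinks.\<close>

lemma card_indep_le: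
  assumes "finite S" "S \<subseteq> U" "acl_indep X" "X \<subseteq> cl S"
  shows "card X \<le> card S"
  using assms(3,4)
proof (induction "card (X - S)" arbitrary: X rule: less_induct)
  case less
  have fX: "finite X" "X \<subseteq> U" using less.prems by (auto simp: acl_indep_def)
  show ?case
  proof (cases "X \<subseteq> S")
    case True
    then show ?thesis using assms(1) card_mono by blast
  next
    case False
    then obtain x where x: "x \<in> X" "x \<notin> S" by blast
    have ind: "acl_indep (X - {x})" using less.prems indep_subset by blast
    \<comment> \<open>Otherwise \<open>x\<close>, being in the closure of \<open>S\<close>, would be
      in the closure of \<open>X - {x}\<close>.\<close>
    have "\<not> S \<subseteq> cl (X - {x})"
      using cl_trans[of "X - {x}" S] fX less.prems x assms(1) by (auto simp: acl_indep_def)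
    then obtain s where s: "s \<in> S" "s \<notin> cl (X - {x})" by blast
    let ?X = "insert s (X - {x})"
    have sX: "s \<notin> X - {x}" using s cl_increasing[of "X - {x}"] fX by blast
    have "?X - S = (X - S) - {x}" using s by blast
    then have "card (?X - S) < card (X - S)"
      using card_Diff1_less[of "X - S" x] fX x by simp
    moreover have "acl_indep ?X" using indep_insert[OF ind] s assms(2) by blast
    moreover have "?X \<subseteq> cl S" using less.prems s cl_increasing[OF assms(2)] by blast
    ultimately have "card ?X \<le> card S" using less.hyps by blast
    moreover have "card ?X = card X"
      using sX fX x by (metis card.insert card_Suc_Diff1 finite_Diff)
    ultimately show ?thesis by simp
  qed
qed

text \<open>A redundant point of \<open>S\<close> could be dropped, leaving a set that spans
  \<open>X\<close> but has fewer points than the independent set \<open>X\<close>.\<close>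

lemma indep_spanning:
  assumes "finite S" "S \<subseteq> U" "acl_indep X" "X \<subseteq> cl S" "card S \<le> card X"
  shows "acl_indep S"
proof (rule ccontr)
  assume "\<not> acl_indep S"
  then obtain s where s: "s \<in> S" "s \<in> cl (S - {s})" using assms by (auto simp: acl_indep_def)
  have "S \<subseteq> cl (S - {s})"
    using s(2) cl_increasing[of "S - {s}"] assms(2) by blast
  then have "X \<subseteq> cl (S - {s})"
    using cl_trans[of "S - {s}" S] assms by blast
  then have "card X \<le> card (S - {s})"
    using card_indep_le[of "S - {s}" X] assms by auto
  moreover have "card (S - {s}) < card S" using s(1) assms(1) by (rule card_Diff1_less[rotated])
  ultimately show False using assms(5) by linarith
qed

text \<open>The points of \<open>Q\<close> are moved into general position over \<open>D\<close> one
  at a time. The next one has an infinite orbit over \<open>A\<close> and the points already placed,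
  whereas the closure of \<open>D\<close> and these points is finite; hence some conjugate avoids
  it.\<close>

lemma generic_copy:
  assumes "finite Q" "finite A" "acl_indep (A \<union> Q)" "A \<inter> Q = {}" "finite D" "A \<subseteq> D" "D \<subseteq> U"
  shows "\<exists>g\<in>stab A. D \<inter> g ` Q = {} \<and> (\<forall>X\<subseteq>D. acl_indep X \<longrightarrow> acl_indep (X \<union> g ` Q))"
  using assms(1,3,4)
proof (induction Q)
  case empty
  have "id \<in> stab A" using id_Aut by (simp add: stab_def)
  then show ?case by (auto intro!: bexI[of _ id])
next
  case (insert q Q)
  have "acl_indep (A \<union> Q)" using insert.prems indep_subset by blast
  then obtain g where g: "g \<in> stab A" "D \<inter> g ` Q = {}"
    "\<And>X. X \<subseteq> D \<Longrightarrow> acl_indep X \<Longrightarrow> acl_indep (X \<union> g ` Q)"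
    using insert by auto
  have AQ: "A \<union> Q \<subseteq> U" and qU: "q \<in> U" using insert.prems by (auto simp: acl_indep_def)
  have "q \<notin> cl (A \<union> Q)"
  proof -
    have "A \<union> insert q Q - {q} = A \<union> Q" using insert by blast
    then show ?thesis using insert.prems(1) by (auto simp: acl_indep_def)
  qed
  then have "g q \<notin> cl (g ` (A \<union> Q))"
    using cl_image_iff[OF stab_Aut[OF g(1)] AQ qU] by blast
  moreover have gA: "g ` (A \<union> Q) = A \<union> g ` Q" using g(1) by (force simp: stab_fix)
  moreover have gqU: "g q \<in> U" using g(1) qU Aut_in stab_Aut by blast
  ultimately have inf: "infinite (orb (A \<union> g ` Q) (g q))" by (simp add: cl_def)
  have gQU: "D \<union> g ` Q \<subseteq> U" using assms g(1) AQ Aut_in stab_Aut by blast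
  have "finite (cl (D \<union> g ` Q))"
    by (intro finite_cl) (use assms(5) insert.hyps gQU in auto)
  have "\<not> orb (A \<union> g ` Q) (g q) \<subseteq> cl (D \<union> g ` Q)"
    using inf by (rule contrapos_nn) (rule finite_subset[OF _ \<open>finite (cl (D \<union> g ` Q))\<close>])
  then obtain y where "y \<in> orb (A \<union> g ` Q) (g q)" and y: "y \<notin> cl (D \<union> g ` Q)"
    by blast
  \<comment> \<open>Since \<open>h\<close> fixes the points already placed, composing with it moves
    only the new one among the copies.\<close>
  then obtain h where h: "h \<in> stab (A \<union> g ` Q)" "y = h (g q)" by (auto simp: orb_def)
  let ?g = "h \<circ> g"
  have gs: "?g \<in> stab A" using g(1) h(1) stab_comp stab_mono[of A "A \<union> g ` Q"] by blast
  have "?g ` Q = g ` Q"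
    by (rule image_cong) (use stab_fix[OF h(1)] in auto)
  then have im: "?g ` insert q Q = insert y (g ` Q)"
    unfolding image_insert by (simp add: h(2))
  have yU: "y \<in> U" using h gqU Aut_in stab_Aut by blast
  have "D \<inter> ?g ` insert q Q = {}"
    unfolding im using g(2) y cl_increasing[OF gQU] by blast
  moreover have "acl_indep (X \<union> ?g ` insert q Q)" if "X \<subseteq> D" "acl_indep X" for X
  proof -
    have "X \<union> g ` Q \<subseteq> D \<union> g ` Q" using that by blast
    then have "y \<notin> cl (X \<union> g ` Q)" using y cl_mono by blast
    then show ?thesis
      unfolding im using indep_insert[OF g(3)[OF that] yU] by simp
  qed
  ultimately show ?case using gs by blast
qed

text \<open>A matroid circuit, except that the empty set qualifies vacuously; lower bounds on the
  cardinality exclude it in the constructions below.\<close>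

definition circuit :: "'a set \<Rightarrow> bool" where
  "circuit C \<longleftrightarrow> finite C \<and> C \<subseteq> U \<and> (\<forall>x\<in>C. x \<in> cl (C - {x}) \<and> acl_indep (C - {x}))"

lemma circuit_proper_indep:
  assumes "circuit C" "X \<subset> C"
  shows "acl_indep X"
proof -
  obtain x where "x \<in> C" "X \<subseteq> C - {x}" using assms(2) by blast
  then show ?thesis using assms(1) indep_subset unfolding circuit_def by blast
qed

text \<open>Glue two copies of the circuit at a point \<open>c\<close>, otherwise in general position, and remove \<open>c\<close>.\<close>

lemma circuit_double:
  assumes C: "circuit C" and card: "3 \<le> card C"
  shows "\<exists>C'. circuit C' \<and> card C < card C'"
proof -
  have fC: "finite C" "C \<subseteq> U" using C by (auto simp: circuit_def)
  obtain c where c: "c \<in> C" using card by fastforce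
  have "card (C - {c}) \<ge> 2" using c card fC by (simp add: card_Diff_singleton)
  then obtain p where p: "p \<in> C" "p \<noteq> c" by (metis Diff_iff card.empty ex_in_conv insertI1 not_numeral_le_zero)
  \<comment> \<open>Since \<open>p\<close> is algebraic over the rest of the circuit, its copy is
    tied to the copies of the other points. Only \<open>Q\<close> is put in general position over
    \<open>c\<close>.\<close>
  define Q where "Q = C - {c, p}"
  have C_eq: "C = insert c (insert p Q)" "c \<notin> Q" "p \<notin> Q" using c p by (auto simp: Q_def)
  have fQ: "finite Q" using fC by (simp add: Q_def)
  have cQ: "acl_indep ({c} \<union> Q)"
    using circuit_proper_indep[OF C, of "{c} \<union> Q"] C_eq p by blast
  obtain g where g: "g \<in> stab {c}" "C \<inter> g ` Q = {}"
    "\<And>X. X \<subseteq> C \<Longrightarrow> acl_indep X \<Longrightarrow> acl_indep (X \<union> g ` Q)"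
    using generic_copy[OF fQ _ cQ _ fC(1) _ fC(2)] C_eq c by auto
  have gA: "g \<in> Aut" and gc: "g c = c" using g(1) by (auto simp: stab_def)
  have inj: "inj_on g C" using Aut_inj_on gA fC by blast
  have gU: "g ` C \<subseteq> U" using fC gA Aut_in by blast
  have g_span: "g x \<in> cl (g ` C - {g x})" if "x \<in> C" for x
  proof -
    have "g x \<in> cl (g ` (C - {x}))"
      using cl_image[OF gA, of "C - {x}" x] C that fC by (auto simp: circuit_def)
    moreover have "g ` (C - {x}) = g ` C - {g x}"
      using inj that by (auto simp: inj_on_def)
    ultimately show ?thesis by simp
  qed
  \<comment> \<open>Otherwise \<open>c\<close> and the copy of \<open>p\<close> would form a proper,
    hence independent, subset of the circuit. By genericity it would stay independent together with
    the copy of \<open>Q\<close>, in contradiction to \<open>g_span\<close>.\<close>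
  have gp: "g p \<notin> C"
  proof
    assume gpC: "g p \<in> C"
    have "card {c, g p} < card C" using card by (simp add: card_insert_if)
    then have "{c, g p} \<subset> C" using c gpC by auto
    then have ind: "acl_indep ({c, g p} \<union> g ` Q)"
      using g(3)[of "{c, g p}"] circuit_proper_indep[OF C] by blast
    have "g ` C - {g p} = {c, g p} \<union> g ` Q - {g p}"
      using C_eq gc by auto
    then show False
      using g_span[OF p(1)] ind by (auto simp: acl_indep_def)
  qed
  define P where "P = C - {c}"
  have P: "P = insert p Q" using C_eq p by (auto simp: P_def)
  have disj: "P \<inter> g ` P = {}" using P gp g(2) C_eq by auto
  \<comment> \<open>An independent set with one point fewer than \<open>C'\<close>. The sets
    \<open>C' - {y}\<close> are compared with it.\<close>
  define X where "X = (C - {p}) \<union> g ` Q"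
  define C' where "C' = P \<union> g ` P"
  have X: "acl_indep X"
    unfolding X_def by (rule g(3)) (use C p in \<open>auto simp: circuit_def\<close>)
  have fC': "finite C'" "C' \<subseteq> U" using fC gU by (auto simp: C'_def P_def)
  have "card Q = card C - 2" using fQ fC C_eq p(2) by simp
  moreover have "card (g ` Q) = card Q"
    using inj_on_subset[OF inj] C_eq by (intro card_image) blast
  moreover have "card X = card (C - {p}) + card (g ` Q)"
    unfolding X_def by (rule card_Un_disjoint) (use fC fQ g(2) in auto)
  ultimately have cX: "card X = 2 * card C - 3"
    using p(1) fC card by (simp add: card_Diff_singleton)
  have "card (g ` P) = card P"
    using inj_on_subset[OF inj] by (intro card_image) (auto simp: P_def)
  moreover have "card C' = card P + card (g ` P)"
    unfolding C'_def by (rule card_Un_disjoint) (use fC disj in \<open>auto simp: P_def\<close>)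
  ultimately have cC': "card C' = 2 * card C - 2"
    using c fC by (simp add: P_def card_Diff_singleton)
  have span: "y \<in> cl (C' - {y}) \<and> X \<subseteq> cl (C' - {y})" if y: "y \<in> C'" for y
  proof -
    let ?S = "C' - {y}"
    have SU: "?S \<subseteq> U" "finite ?S" using fC' by auto
    \<comment> \<open>Removing \<open>y\<close> spoils only one of the two glued circuits. The
      intact one, \<open>C2\<close>, gives back \<open>c\<close>, and with \<open>c\<close>
      available the other one, \<open>C1\<close>, gives back \<open>y\<close>.\<close>
    have key: "C1 \<union> C2 \<subseteq> cl ?S"
      if "finite C1" "finite C2" and C2: "C2 - {c} \<subseteq> ?S" "c \<in> C2" "c \<in> cl (C2 - {c})"
        and C1: "C1 - {c} - {y} \<subseteq> ?S" "y \<in> C1 \<Longrightarrow> y \<in> cl (C1 - {y})" for C1 C2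
    proof -
      have 1: "c \<in> cl ?S" using C2 cl_mono by blast
      then have 2: "C2 \<subseteq> cl ?S" using C2 cl_increasing[OF SU(1)] by blast
      have 3: "C1 - {y} \<subseteq> cl ?S" using 1 C1 cl_increasing[OF SU(1)] by blast
      then have "y \<in> cl ?S" if "y \<in> C1"
        using cl_trans[OF SU(1), of "C1 - {y}"] C1(2) that \<open>finite C1\<close> by blast
      then show ?thesis using 2 3 by blast
    qed
    have gCc: "g ` C - {c} = g ` P"
      using inj c gc by (auto simp: P_def inj_on_def)
    have cgC: "c \<in> g ` C" using c gc by force
    have cgcl: "c \<in> cl (g ` C - {c})" using g_span[OF c] gc by simp
    have span': "C \<union> g ` C \<subseteq> cl ?S"
    proof (cases "y \<in> P")
      case True
      then have "y \<notin> g ` P" using disj by blast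
      then show ?thesis
        using True C cgC cgcl c fC
        by (intro key) (auto simp: C'_def circuit_def gCc P_def)
    next
      case False
      then have "y \<in> g ` P" using y by (auto simp: C'_def)
      then obtain x where "x \<in> C" "y = g x" by (auto simp: P_def)
      moreover have "g ` C \<union> C \<subseteq> cl ?S"
        using False C g_span[OF \<open>x \<in> C\<close>] c fC \<open>y = g x\<close> cgC
        by (intro key) (auto simp: C'_def circuit_def gCc P_def)
      ultimately show ?thesis by blast
    qed
    moreover have "y \<in> C \<union> g ` C" "X \<subseteq> C \<union> g ` C"
      using y by (auto simp: C'_def X_def P_def Q_def)
    ultimately show ?thesis by blast
  qed
  have "circuit C'"
    unfolding circuit_def
  proof (intro conjI ballI fC')
    fix y assume y: "y \<in> C'"
    show "y \<in> cl (C' - {y})" using span[OF y] by blast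
    \<comment> \<open>This is the size of \<open>X\<close>, so a set of this size spanning
      \<open>X\<close> is independent.\<close>
    have "card (C' - {y}) = 2 * card C - 3"
      using y cC' fC' by (simp add: card_Diff_singleton)
    then show "acl_indep (C' - {y})"
      using indep_spanning[of "C' - {y}" X] fC' X span[OF y] cX by auto
  qed
  then show ?thesis using cC' card by (intro exI[of _ C']) auto
qed

lemma large_circuit:
  assumes "circuit C" "3 \<le> card C"
  shows "\<exists>C'. circuit C' \<and> n \<le> card C'"
proof -
  \<comment> \<open>The summand 3 keeps every circuit large enough to be doubled again.\<close>
  have "\<exists>C'. circuit C' \<and> 3 + n \<le> card C'"
  proof (induction n)
    case 0
    then show ?case using assms by auto
  next
    case (Suc n)
    then obtain C1 where "circuit C1" "3 + n \<le> card C1" by blast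
    then show ?case using circuit_double[of C1] by fastforce
  qed
  then show ?thesis by (meson le_trans le_add2)
qed

text \<open>A smallest finite \<open>F\<close> inside \<open>A\<close> with \<open>b\<close> in its
  closure gives a circuit \<open>insert b F\<close>: minimality makes \<open>F\<close> independent,
  exchange puts each point of \<open>F\<close> into the closure of the others and \<open>b\<close>.
  It has at least two points besides \<open>b\<close> because no single point of \<open>A\<close>
  suffices.\<close>

lemma circuit_if_not_acl_trivial:
  assumes "\<not> acl_trivial V M"
  shows "\<exists>C. circuit C \<and> 3 \<le> card C"
proof -
  obtain A b where A: "A \<subseteq> U" "A \<noteq> {}" and b: "b \<in> U" "b \<in> acl V M A"
    and nt: "\<And>a. a \<in> A \<Longrightarrow> b \<notin> acl V M {a}"
    using assms unfolding acl_trivial_def by blast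
  have not1: "b \<notin> cl F" if "F \<subseteq> {a}" "a \<in> A" for F a
    using nt[OF that(2)] acl_iff_orb[of "{a}" b] that A finite_subset[OF that(1)]
    by (auto simp: cl_def)
  obtain F0 where F0: "F0 \<subseteq> A" "finite F0" "b \<in> cl F0"
    using b acl_iff_orb[OF A(1)] by (auto simp: cl_def)
  define F where "F = arg_min card (\<lambda>F. F \<subseteq> A \<and> finite F \<and> b \<in> cl F)"
  have F: "F \<subseteq> A" "finite F" "b \<in> cl F"
    using arg_min_natI[of "\<lambda>F. F \<subseteq> A \<and> finite F \<and> b \<in> cl F" F0 card] F0 unfolding F_def by auto
  have Fmin: "card F \<le> card G" if "G \<subseteq> A" "finite G" "b \<in> cl G" for G
    using arg_min_nat_le[of "\<lambda>F. F \<subseteq> A \<and> finite F \<and> b \<in> cl F" G card] that unfolding F_def by auto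
  have FU: "F \<subseteq> U" using F A by blast
  have drop: "b \<notin> cl (F - {x})" if "x \<in> F" for x
    using Fmin[of "F - {x}"] F that card_Diff1_less[of F x] by fastforce
  have indF: "acl_indep F"
    unfolding acl_indep_def
  proof (intro conjI ballI F FU notI)
    fix x assume x: "x \<in> F" "x \<in> cl (F - {x})"
    then have "F \<subseteq> cl (F - {x})" using cl_increasing[of "F - {x}"] FU by blast
    then have "b \<in> cl (F - {x})" using cl_trans[of "F - {x}" F] F FU by blast
    then show False using drop x by blast
  qed
  have "2 \<le> card F"
  proof (rule ccontr)
    assume "\<not> 2 \<le> card F"
    then have "card F = 0 \<or> card F = 1" by linarith
    \<comment> \<open>An empty \<open>F\<close> also lies in a singleton from \<open>A\<close>,
      since \<open>A\<close> is nonempty.\<close>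
    then have "\<exists>a\<in>A. F \<subseteq> {a}"
      using F A(2) by (auto simp: card_1_singleton_iff)
    then show False using not1 F(3) by blast
  qed
  have bF: "b \<notin> F"
  proof
    assume "b \<in> F"
    then show False using not1[of "{b}" b] cl_increasing[of "{b}"] F b by blast
  qed
  have "circuit (insert b F)"
    unfolding circuit_def
  proof (intro conjI ballI)
    fix x assume x: "x \<in> insert b F"
    show "x \<in> cl (insert b F - {x})"
    proof (cases "x = b")
      case False
      then have xF: "x \<in> F" using x by simp
      have eq: "insert b F - {x} = insert b (F - {x})" "insert x (F - {x}) = F"
        using False xF by auto
      show ?thesis
        unfolding eq using exchange[of "F - {x}" x b] F FU drop[OF xF] xF eq by auto
    qed (use bF F in simp)
    show "acl_indep (insert b F - {x})"
    proof (cases "x = b")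
      case False
      then have xF: "x \<in> F" using x by simp
      have eq: "insert b F - {x} = insert b (F - {x})"
        using False xF by auto
      show ?thesis
        unfolding eq using indep_insert[OF indep_subset[OF indF], of "F - {x}" b] drop[OF xF] b by blast
    qed (use bF indF in simp)
  qed (use F FU b in auto)
  moreover have "3 \<le> card (insert b F)" using \<open>2 \<le> card F\<close> bF F by simp
  ultimately show ?thesis by blast
qed

end

section \<open>Constraints inside forbidden structures\<close>

definition restr :: "('r, 'a) struct \<Rightarrow> 'a set \<Rightarrow> ('r, 'a) struct" where
  "restr D S = \<lparr>univ = S, rel = \<lambda>R. rel D R \<inter> lists S\<rparr>"

lemma permitted_comp: "embedding V A B f \<Longrightarrow> permitted V M B \<Longrightarrow> permitted V M A"
  unfolding permitted_def using embedding_comp by blast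

text \<open>A smallest nonempty set inducing a forbidden substructure induces a constraint. It is
  copied to the natural numbers, where \<open>finitely_constrained\<close> looks for
  constraints.\<close>

lemma constraint_inside_forbidden:
  fixes D :: "('r, 'd) struct"
  assumes D: "is_struct V D" "finite (univ D)" "\<not> permitted V M D"
  shows "\<exists>(F :: ('r, nat) struct) S. is_constraint V M F \<and> S \<subseteq> univ D \<and> card S = card (univ F) \<and>
    \<not> permitted V M (restr D S)"
proof -
  define P where "P S \<longleftrightarrow> S \<subseteq> univ D \<and> S \<noteq> {} \<and> \<not> permitted V M (restr D S)" for S
  have "embedding V D (restr D (univ D)) id"
    by (auto simp: embedding_def restr_def)
  then have "P (univ D)"
    using D permitted_comp unfolding P_def is_struct_def by blast
  then obtain S where S: "P S" and S_min: "\<And>S'. P S' \<Longrightarrow> card S \<le> card S'"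
    using arg_min_natI[of P _ card] arg_min_nat_le[of P _ card] by metis
  have finS: "finite S" using S D(2) finite_subset by (auto simp: P_def)
  obtain h :: "'d \<Rightarrow> nat" where h: "inj_on h S"
    using finite_imp_inj_to_nat_seg[OF finS] by blast
  define F where "F = \<lparr>univ = h ` S, rel = \<lambda>R. map h ` (rel D R \<inter> lists S)\<rparr>"
  \<comment> \<open>Stated for all substructures of the copy: \<open>S' = S\<close> shows that
    \<open>F\<close> is forbidden, and a smaller \<open>S'\<close> that a proper substructure is
    permitted.\<close>
  have iso: "iso V (restr D S') G h"
    if "substruct V G F" "S' \<subseteq> S" "univ G = h ` S'" for G S'
    unfolding iso_def embedding_def
  proof (intro conjI ballI)
    show "inj_on h (univ (restr D S'))" using h that(2) by (simp add: restr_def inj_on_subset)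
    fix R xs assume R: "R \<in> syms V" and "xs \<in> lists (univ (restr D S'))"
    then have xs: "xs \<in> lists S'" by (simp add: restr_def)
    then have "xs \<in> lists S" "map h xs \<in> lists (univ G)" using that by auto
    moreover have "inj_on (map h) (lists S)"
      using h by (auto simp: inj_on_def in_lists_conv_set intro!: map_inj_on[OF _ inj_on_subset[OF h]])
    then have "map h xs \<in> map h ` (rel D R \<inter> lists S) \<longleftrightarrow> xs \<in> rel D R \<inter> lists S"
      using \<open>xs \<in> lists S\<close> by (simp add: inj_on_image_mem_iff)
    ultimately show "xs \<in> rel (restr D S') R \<longleftrightarrow> map h xs \<in> rel G R"
      using that(1) R xs by (simp add: substruct_def F_def restr_def)
  qed (use that in \<open>simp_all add: restr_def\<close>)
  have F: "is_struct V F"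
    using S D(1) by (auto simp: is_struct_def F_def P_def)
  then have subF: "substruct V F F"
    by (auto simp: substruct_def is_struct_def)
  have "is_constraint V M F"
    unfolding is_constraint_def
  proof (intro conjI allI impI F)
    show "finite (univ F)" using finS by (simp add: F_def)
    have "embedding V (restr D S) F h"
      using iso[OF subF, of S] by (simp add: iso_def F_def)
    then show "\<not> permitted V M F"
      using S permitted_comp unfolding P_def by blast
    fix G assume G: "substruct V G F \<and> univ G \<noteq> univ F"
    then have "univ G \<subseteq> h ` S" "univ G \<noteq> {}"
      by (auto simp: substruct_def F_def is_struct_def)
    then obtain S' where S': "S' \<subseteq> S" "univ G = h ` S'" by (meson subset_image_iff)
    then have "S' \<subset> S" "S' \<noteq> {}" using G \<open>univ G \<noteq> {}\<close> by (auto simp: F_def)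
    then have "\<not> P S'" using S_min[of S'] psubset_card_mono[OF finS, of S'] by auto
    then have "permitted V M (restr D S')"
      using S S'(1) \<open>S' \<noteq> {}\<close> by (auto simp: P_def)
    then show "permitted V M G"
      using permitted_comp iso_inv_into[OF iso[of G S']] G S' unfolding iso_def by blast
  qed
  moreover have "card S = card (univ F)" using h by (simp add: F_def card_image)
  ultimately show ?thesis using S unfolding P_def by blast
qed

lemma constraint_card_bound:
  fixes M :: "('r, 'a) struct"
  assumes "finitely_constrained V M"
  shows "\<exists>N. \<forall>F :: ('r, nat) struct. is_constraint V M F \<longrightarrow> card (univ F) \<le> N"
proof -
  obtain C :: "('r, nat) struct set" where C: "finite C"
    "\<And>F :: ('r, nat) struct. is_constraint V M F \<Longrightarrow> \<exists>G\<in>C. \<exists>f. iso V F G f"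
    using assms unfolding finitely_constrained_def by blast
  have "card (univ F) \<le> Max ((\<lambda>G. card (univ G)) ` C)" if F: "is_constraint V M F" for F :: "('r, nat) struct"
  proof -
    obtain G f where "G \<in> C" "iso V F G f" using C(2)[OF F] by blast
    moreover from this have "card (univ F) = card (univ G)"
      by (intro bij_betw_same_card[of f]) (auto simp: iso_def embedding_def bij_betw_def)
    ultimately show ?thesis using C(1) by (auto intro: Max_ge)
  qed
  then show ?thesis by blast
qed

section \<open>Large constraints from large circuits\<close>

text \<open>Finite Ramsey with colours in any finite set and increasing pairs from any large finite
  set of numbers. The bound depends only on \<open>Q\<close> and \<open>k\<close>, so it can be
  fixed before the index set is known.\<close>

lemma ramsey_pairs:
  assumes "finite Q"
  shows "\<exists>K::nat. \<forall>(I :: nat set) f. finite I \<and> K \<le> card I \<and>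
    (\<forall>i\<in>I. \<forall>j\<in>I. i < j \<longrightarrow> f i j \<in> Q) \<longrightarrow>
    (\<exists>J q. J \<subseteq> I \<and> card J = k \<and> q \<in> Q \<and> (\<forall>i\<in>J. \<forall>j\<in>J. i < j \<longrightarrow> f i j = q))"
proof -
  obtain col :: "'a \<Rightarrow> nat" and n where col: "col ` Q = {i. i < n}" "inj_on col Q"
    using finite_imp_inj_to_nat_seg[OF assms] by blast
  obtain K :: nat where K: "partn_lst {..<K} (replicate n k) 2" using ramsey_full by blast
  have "\<exists>J q. J \<subseteq> I \<and> card J = k \<and> q \<in> Q \<and> (\<forall>i\<in>J. \<forall>j\<in>J. i < j \<longrightarrow> f i j = q)"
    if I: "finite I" "K \<le> card I" and f: "\<forall>i\<in>I. \<forall>j\<in>I. i < j \<longrightarrow> f i j \<in> Q"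
    for I :: "nat set" and f
  proof -
    define y where "y = (!) (sorted_list_of_set I)"
    have y_in: "y i \<in> I" if "i < K" for i
      using that I by (metis y_def le_trans length_sorted_list_of_set less_le_trans nth_mem set_sorted_list_of_set)
    have y_mono: "y i < y j" if "i < j" "j < K" for i j
      unfolding y_def using that I sorted_wrt_nth_less[OF strict_sorted_list_of_set[of I]] by auto
    \<comment> \<open>The colouring concerns ordered pairs; minimum and maximum recover the order
      from a two-element set.\<close>
    define F where "F X = col (f (y (Min X)) (y (Max X)))" for X
    have F_pair: "F {i, j} = col (f (y i) (y j))" if "i < j" for i j
      using that by (simp add: F_def min_def max_def)
    have F_range: "F \<in> nsets {..<K} 2 \<rightarrow> {..<n}"
    proof
      fix X assume "X \<in> nsets {..<K} 2"
      then obtain i j where ij: "X = {i, j}" "i < j" "j < K"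
        by (auto elim!: nsets2_E) (metis insert_commute linorder_neqE_nat)
      then have "f (y i) (y j) \<in> Q" using f y_in y_mono by simp
      then show "F X \<in> {..<n}" using F_pair[OF ij(2)] ij(1) col(1) by blast
    qed
    have "F \<in> nsets {..<K} 2 \<rightarrow> {..<length (replicate n k)}" using F_range by simp
    with K have "\<exists>i<length (replicate n k). monochromatic {..<K} (replicate n k ! i) 2 F i"
      unfolding partn_lst_def by (rule bspec)
    then obtain i where i: "i < n" "monochromatic {..<K} k 2 F i" by auto
    then obtain H where H: "H \<in> nsets {..<K} k" "F ` nsets H 2 \<subseteq> {i}"
      unfolding monochromatic_def by blast
    have "i \<in> col ` Q" using i(1) col(1) by simp
    then obtain q where q: "q \<in> Q" "col q = i" by blast
    have Hf: "H \<subseteq> {..<K}" "card H = k" using H(1) by (auto simp: nsets_def)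
    have inj: "inj_on y H"
      using y_mono Hf(1) by (intro linorder_inj_onI) fastforce+
    have "f (y a) (y a') = q" if "a \<in> H" "a' \<in> H" "y a < y a'" for a a'
    proof -
      have "a < a'"
      proof (rule ccontr)
        assume "\<not> a < a'"
        then consider "a = a'" | "a' < a" by linarith
        then show False using that y_mono[of a' a] Hf(1) by cases auto
      qed
      then have "{a, a'} \<in> nsets H 2" using that by auto
      then have "F {a, a'} = i" using H(2) by blast
      then have "col (f (y a) (y a')) = col q" using F_pair[OF \<open>a < a'\<close>] q(2) by simp
      moreover have "f (y a) (y a') \<in> Q" using f y_in that Hf(1) by blast
      ultimately show ?thesis using col(2) q(1) by (simp add: inj_on_eq_iff)
    qed
    then show ?thesis
      using q(1) y_in Hf inj by (intro exI[of _ "y ` H"] exI[of _ q]) (auto simp: card_image)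
  qed
  then show ?thesis by blast
qed

lemma sorted_list_of_set_image_strict_mono:
  fixes y :: "nat \<Rightarrow> nat"
  assumes "strict_mono y" "finite J"
  shows "sorted_list_of_set (y ` J) = map y (sorted_list_of_set J)"
proof (rule strict_sorted_equal)
  show "sorted_wrt (<) (map y (sorted_list_of_set J))"
    unfolding sorted_wrt_map
    by (rule sorted_wrt_mono_rel[OF _ strict_sorted_list_of_set]) (use assms in \<open>simp add: strict_monoD\<close>)
qed (use assms in simp_all)

section \<open>Indiscernible sequences and witnesses\<close>

context homogeneous_struct
begin

text \<open>Infinite Ramsey makes the type over \<open>B\<close> of increasing
  \<open>k\<close>-tuples constant, and homogeneity turns equality of types into automorphisms over
  \<open>B\<close>.\<close>

lemma indiscernible_subsequence:
  assumes B: "finite B" "B \<subseteq> U" and es: "inj es" "range es \<subseteq> U"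
  shows "\<exists>y :: nat \<Rightarrow> nat. strict_mono y \<and>
    (\<forall>J J'. finite J \<and> finite J' \<and> card J = k \<and> card J' = k \<longrightarrow>
      (\<exists>h\<in>stab B. map h (map (es \<circ> y) (sorted_list_of_set J)) = map (es \<circ> y) (sorted_list_of_set J')))"
proof -
  obtain bs where bs: "set bs = B" using finite_list B by blast
  \<comment> \<open>Appending \<open>bs\<close> makes this a type over \<open>B\<close>, so that an
    automorphism matching two such tuples fixes \<open>B\<close> pointwise.\<close>
  define t where "t X = qftp V M (map es (sorted_list_of_set X) @ bs)" for X
  define m where "m = k + length bs"
  let ?Q = "(\<lambda>xs. qftp V M xs) ` {xs :: 'a list. length xs = m}"
  obtain col :: "'r fm set \<Rightarrow> nat" and s where col: "col ` ?Q = {i. i < s}" "inj_on col ?Q"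
    using finite_imp_inj_to_nat_seg[OF finite_qftps[of m]] by (elim exE conjE)
  have t_in: "t X \<in> ?Q" if "finite X" "card X = k" for X
    using that by (auto simp: t_def m_def)
  have "\<exists>Y i. Y \<subseteq> UNIV \<and> infinite Y \<and> i < s \<and>
      (\<forall>X. X \<subseteq> Y \<and> finite X \<and> card X = k \<longrightarrow> (col \<circ> t) X = i)"
    by (rule Ramsey) (use t_in col(1) in auto)
  then obtain Y i where Y: "infinite Y" "\<And>X. X \<subseteq> Y \<Longrightarrow> finite X \<Longrightarrow> card X = k \<Longrightarrow> col (t X) = i"
    by auto
  let ?y = "enumerate Y"
  have mono: "strict_mono ?y" using Y(1) strict_mono_enumerate by blast
  have "\<exists>h\<in>stab B. map h (map (es \<circ> ?y) (sorted_list_of_set J)) = map (es \<circ> ?y) (sorted_list_of_set J')"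
    if J: "finite J" "finite J'" "card J = k" "card J' = k" for J J'
  proof -
    have sub: "?y ` J \<subseteq> Y" "?y ` J' \<subseteq> Y" using Y(1) by (auto simp: enumerate_in_set)
    have card: "card (?y ` J) = k" "card (?y ` J') = k"
      using J strict_mono_imp_inj_on[OF mono] by (auto simp: card_image inj_on_subset)
    have "col (t (?y ` J)) = col (t (?y ` J'))"
      using Y(2) sub card J by simp
    then have eq: "t (?y ` J) = t (?y ` J')"
      by (rule inj_onD[OF col(2)]) (use t_in card J in simp_all)
    have "\<exists>h\<in>Aut. map h (map es (sorted_list_of_set (?y ` J)) @ bs) = map es (sorted_list_of_set (?y ` J')) @ bs"
      by (rule qftp_eqD) (use eq es(2) bs B J card in \<open>auto simp: t_def\<close>)
    then obtain h where h: "h \<in> Aut"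
      "map h (map es (sorted_list_of_set (?y ` J)) @ bs) = map es (sorted_list_of_set (?y ` J')) @ bs"
      by blast
    moreover have "length (map es (sorted_list_of_set (?y ` J))) = length (map es (sorted_list_of_set (?y ` J')))"
      using card by simp
    ultimately have "map h (map es (sorted_list_of_set (?y ` J))) = map es (sorted_list_of_set (?y ` J'))"
      "map h bs = bs"
      by (simp_all add: append_eq_append_conv)
    then show ?thesis
      using stab_map[OF h(1), of bs] bs J sorted_list_of_set_image_strict_mono[OF mono]
      by (intro bexI[of _ h]) simp_all
  qed
  with mono show ?thesis by (intro exI[of _ ?y]) simp
qed

text \<open>The first conjunct determines the types of all triples from \<open>c\<close>, \<open>A\<close> and \<open>us\<close> that contain at most
  one entry of \<open>us\<close>; the parameter \<open>q\<close> covers the others.\<close>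

definition witness :: "'a set \<Rightarrow> 'a \<Rightarrow> 'a \<Rightarrow> 'a list \<Rightarrow> 'r fm set \<Rightarrow> 'a \<Rightarrow> bool" where
  "witness A b e us q c \<longleftrightarrow> (\<forall>u\<in>set us. \<exists>g\<in>stab A. g b = c \<and> g e = u) \<and>
     (\<forall>j<length us. \<forall>i<j. qftp V M [c, us ! i, us ! j] = q)"

lemma witness_mono: "A \<subseteq> A' \<Longrightarrow> witness A' b e us q c \<Longrightarrow> witness A b e us q c"
  unfolding witness_def using stab_mono by blast

text \<open>Short tuples cannot tell two witnesses apart. If a tuple contains the witness and two
  distinct entries of \<open>us\<close>, then there is no room for more and its type is controlled
  by \<open>q\<close>. Otherwise, with at most one entry \<open>u\<close>, the pair
  \<open>(c1, u)\<close> is moved to \<open>(b, e)\<close> and on to \<open>(c2, u)\<close>, both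
  times over \<open>A\<close>. \<open>None\<close> stands for the witness.\<close>

lemma witness_conjugate:
  assumes w1: "witness A1 b e us q c1" and w2: "witness A2 b e us q c2"
    and A: "A \<subseteq> A1" "A \<subseteq> A2" "A1 \<subseteq> U" and b: "b \<in> U" "e \<in> U" and us: "us \<noteq> []" "set us \<subseteq> U"
    and xs: "set xs \<subseteq> insert None (Some ` (A \<union> set us))" "length xs \<le> 3"
  shows "\<exists>h\<in>Aut. map h (map (case_option c1 id) xs) = map (case_option c2 id) xs"
proof (cases "None \<in> set xs")
  case False
  then have "map id (map (case_option c1 id) xs) = map (case_option c2 id) xs"
    by (auto split: option.split)
  then show ?thesis using id_Aut by blast
next
  case None: True
  show ?thesis
  proof (cases "\<exists>j<length us. \<exists>i<j. Some (us ! i) \<in> set xs \<and> Some (us ! j) \<in> set xs \<and> us ! i \<noteq> us ! j")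
    case True
    then obtain i j where ij: "j < length us" "i < j" "us ! i \<noteq> us ! j"
      "Some (us ! i) \<in> set xs" "Some (us ! j) \<in> set xs" by blast
    let ?T = "{None, Some (us ! i), Some (us ! j)}"
    have "card ?T = 3" using ij by simp
    moreover have "?T \<subseteq> set xs" using None ij by blast
    moreover have "card (set xs) \<le> 3" using xs(2) card_length le_trans by blast
    ultimately have set_xs: "set xs = ?T" by (metis List.finite_set card_seteq)
    have c: "c1 \<in> U" "c2 \<in> U"
      using w1 w2 us b Aut_in stab_Aut unfolding witness_def by (metis list.set_intros(1) neq_Nil_conv)+
    have "qftp V M [c1, us ! i, us ! j] = qftp V M [c2, us ! i, us ! j]"
      using w1 w2 ij by (simp add: witness_def)
    moreover have "us ! i \<in> U" "us ! j \<in> U" using us(2) ij by auto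
    ultimately obtain h where "h \<in> Aut" "map h [c1, us ! i, us ! j] = [c2, us ! i, us ! j]"
      using qftp_eqD[of "[c1, us ! i, us ! j]" "[c2, us ! i, us ! j]"] c by auto
    then show ?thesis using set_xs by (intro bexI[of _ h]) auto
  next
    case False
    have "\<exists>u\<in>set us. \<forall>v\<in>set us. Some v \<in> set xs \<longrightarrow> v = u"
    proof (cases "\<exists>u\<in>set us. Some u \<in> set xs")
      case True
      then obtain u where u: "u \<in> set us" "Some u \<in> set xs" by blast
      then have "v = u" if "v \<in> set us" "Some v \<in> set xs" for v
        using False that by (metis in_set_conv_nth linorder_neqE_nat)
      then show ?thesis using u(1) by blast
    next
      case False
      then show ?thesis using us(1) by (metis list.set_intros(1) neq_Nil_conv)
    qed
    then obtain u where u: "u \<in> set us" "\<And>v. v \<in> set us \<Longrightarrow> Some v \<in> set xs \<Longrightarrow> v = u" by blast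
    obtain g1 where g1: "g1 \<in> stab A1" "g1 b = c1" "g1 e = u"
      using w1 u(1) unfolding witness_def by blast
    obtain g2 where g2: "g2 \<in> stab A2" "g2 b = c2" "g2 e = u"
      using w2 u(1) unfolding witness_def by blast
    obtain k where k: "k \<in> stab A1" "\<And>x. x \<in> U \<Longrightarrow> k (g1 x) = x" "\<And>x. x \<in> U \<Longrightarrow> g1 (k x) = x"
      using stab_inv[OF g1(1) A(3)] by blast
    have kb: "k c1 = b" "k u = e" using k(2) b g1 by auto
    have "(g2 \<circ> k) (case_option c1 id x) = case_option c2 id x" if "x \<in> set xs" for x
    proof (cases x)
      case (Some a)
      show ?thesis
      proof (cases "a \<in> set us")
        case True
        then show ?thesis using u(2)[of a] Some that kb g2 by simp
      next
        case False
        then have "a \<in> A1" "a \<in> A2" using Some that xs(1) A by auto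
        then show ?thesis using Some stab_fix[OF k(1)] stab_fix[OF g2(1)] by simp
      qed
    qed (use kb g2 in simp)
    then have "map (g2 \<circ> k) (map (case_option c1 id) xs) = map (case_option c2 id) xs"
      by simp
    moreover have "g2 \<circ> k \<in> Aut" using Aut_comp stab_Aut g2 k by blast
    ultimately show ?thesis by blast
  qed
qed

end

section \<open>Uniform witnesses and the forbidden structure\<close>

context rank_one_struct
begin

text \<open>Nondividing gives a point related to many terms of an indiscernible sequence as
  \<open>b\<close> is to \<open>e\<close>, and Ramsey thins these to \<open>k\<close> terms with a
  constant \<open>q\<close>. An automorphism over \<open>B\<close> moves them to the first
  \<open>k\<close> terms, so that \<open>us\<close> is the same for all \<open>A\<close>.\<close>

lemma ex_witnesses:
  assumes B: "finite B" "B \<subseteq> U" and be: "b \<in> U" "e \<in> U" "e \<notin> cl B"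
  obtains us where "length us = k" "distinct us" "set us \<subseteq> orb B e"
    "\<And>A. A \<subseteq> B \<Longrightarrow> b \<notin> cl (insert e A) \<Longrightarrow>
      \<exists>q\<in>(\<lambda>xs. qftp V M xs) ` {xs :: 'a list. length xs = 3}. \<exists>c. witness A b e us q c"
proof -
  have "infinite (orb B e)" using be by (simp add: cl_def)
  then obtain es :: "nat \<Rightarrow> 'a" where es: "inj es" "range es \<subseteq> orb B e"
    using infinite_countable_subset by blast
  then have esU: "range es \<subseteq> U" using orb_subset[OF be(2)] by blast
  obtain y :: "nat \<Rightarrow> nat" where y: "strict_mono y"
    and hom: "\<forall>J J'. finite J \<and> finite J' \<and> card J = k \<and> card J' = k \<longrightarrow>
      (\<exists>h\<in>stab B. map h (map (es \<circ> y) (sorted_list_of_set J)) = map (es \<circ> y) (sorted_list_of_set J'))"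
    using indiscernible_subsequence[OF B es(1) esU, of k] by (elim exE conjE) (rule that)
  let ?s = "es \<circ> y"
  let ?Q = "(\<lambda>xs. qftp V M xs) ` {xs :: 'a list. length xs = 3}"
  have inj: "inj ?s" using es(1) strict_mono_imp_inj_on[OF y] by (simp add: inj_compose)
  define us where "us = map ?s (sorted_list_of_set {..<k})"
  obtain K where K: "\<forall>(I :: nat set) f. finite I \<and> K \<le> card I \<and>
      (\<forall>i\<in>I. \<forall>j\<in>I. i < j \<longrightarrow> f i j \<in> ?Q) \<longrightarrow>
      (\<exists>J q. J \<subseteq> I \<and> card J = k \<and> q \<in> ?Q \<and> (\<forall>i\<in>J. \<forall>j\<in>J. i < j \<longrightarrow> f i j = q))"
    using ramsey_pairs[OF finite_qftps[of 3], of k] by (elim exE) (rule that)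
  have "\<exists>q\<in>?Q. \<exists>c. witness A b e us q c" if A: "A \<subseteq> B" and b: "b \<notin> cl (insert e A)" for A
  proof -
    have A': "finite A" "A \<subseteq> U" using A B finite_subset by auto
    \<comment> \<open>Terms conjugate to \<open>e\<close> over \<open>B\<close> are conjugate to it
      over every \<open>A \<subseteq> B\<close>, so nondividing applies over \<open>A\<close> to the
      same sequence.\<close>
    have sA: "?s i \<in> orb A e" for i using es(2) orb_mono[OF A] by auto
    obtain I c where I: "finite I" "card I = Suc K" "\<And>i. i \<in> I \<Longrightarrow> \<exists>g\<in>stab A. g b = c \<and> g e = ?s i"
      by (rule nondividing_over[OF A' be(1,2) b, of ?s "Suc K"]) (use sA in auto)
    obtain J q where J: "J \<subseteq> I" "card J = k" "q \<in> ?Q"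
      "\<forall>i\<in>J. \<forall>j\<in>J. i < j \<longrightarrow> qftp V M [c, ?s i, ?s j] = q"
      using K[THEN spec, THEN spec, THEN mp, of I "\<lambda>i j. qftp V M [c, ?s i, ?s j]"] I(1,2) by auto
    have fJ: "finite J" using J(1) I(1) finite_subset by blast
    let ?l = "sorted_list_of_set J"
    obtain h where h: "h \<in> stab B" "map h (map ?s ?l) = us"
      using hom[rule_format, of J "{..<k}"] fJ J(2) unfolding us_def by auto
    have hA: "h \<in> stab A" using h(1) stab_mono[OF A] by blast
    have "witness A b e us q (h c)"
      unfolding witness_def
    proof (intro conjI ballI allI impI)
      fix u assume "u \<in> set us"
      then obtain j where j: "j \<in> J" "u = h (?s j)" unfolding h(2)[symmetric] using fJ by auto
      then obtain g where g: "g \<in> stab A" "g b = c" "g e = ?s j" using I(3) J(1) by blast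
      then show "\<exists>g\<in>stab A. g b = h c \<and> g e = u"
        using j(2) stab_comp[OF g(1) hA] by (intro bexI[of _ "h \<circ> g"]) auto
    next
      fix i j assume ij: "j < length us" "i < j"
      have len: "length us = length ?l" unfolding h(2)[symmetric] by simp
      have us_nth: "us ! n = h (?s (?l ! n))" if "n < length us" for n
        using that len unfolding h(2)[symmetric] by simp
      have lJ: "?l ! i \<in> J" "?l ! j \<in> J" "?l ! i < ?l ! j"
        using ij len fJ sorted_wrt_nth_less[OF strict_sorted_list_of_set[of J], of i j]
          nth_mem[of i ?l] nth_mem[of j ?l] by auto
      have "J \<noteq> {}" using lJ by blast
      then obtain i0 where "i0 \<in> J" by blast
      then have cU: "c \<in> U" using I(3)[of i0] J(1) be(1) Aut_in stab_Aut by blast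
      have "qftp V M [h c, us ! i, us ! j] = qftp V M (map h [c, ?s (?l ! i), ?s (?l ! j)])"
        using us_nth ij by simp
      also have "\<dots> = qftp V M [c, ?s (?l ! i), ?s (?l ! j)]"
        by (rule qftp_map) (use h(1) stab_Aut cU esU in auto)
      also have "\<dots> = q" using J(4) lJ by simp
      finally show "qftp V M [h c, us ! i, us ! j] = q" .
    qed
    then show ?thesis using J(3) by blast
  qed
  moreover have "length us = k" "distinct us" "set us \<subseteq> orb B e"
    using es(2) inj_on_subset[OF inj subset_UNIV] by (auto simp: us_def distinct_map)
  ultimately show ?thesis using that by blast
qed

text \<open>Only finitely many \<open>q\<close> are possible.  If each of them failed for some small \<open>A \<subseteq> B\<close>, then all of
  them would fail for the union of these sets, which is still a proper subset of \<open>B\<close>.\<close>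

lemma ex_uniform_witnesses:
  assumes B: "finite B" "B \<subseteq> U" and be: "b \<in> U" "e \<in> U" "e \<notin> cl B"
    and proper: "\<And>A. A \<subset> B \<Longrightarrow> b \<notin> cl (insert e A)"
    and large: "card ((\<lambda>xs. qftp V M xs) ` {xs :: 'a list. length xs = 3}) * N < card B"
  obtains us q where "length us = k" "distinct us" "set us \<subseteq> orb B e"
    "\<And>A. A \<subseteq> B \<Longrightarrow> card A \<le> N \<Longrightarrow> \<exists>c. witness A b e us q c"
proof -
  let ?Q = "(\<lambda>xs. qftp V M xs) ` {xs :: 'a list. length xs = 3}"
  obtain us where us: "length us = k" "distinct us" "set us \<subseteq> orb B e"
    and w: "\<And>A. A \<subseteq> B \<Longrightarrow> b \<notin> cl (insert e A) \<Longrightarrow> \<exists>q\<in>?Q. \<exists>c. witness A b e us q c"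
    using ex_witnesses[OF B be, of k] by blast
  have "\<exists>q. \<forall>A. A \<subseteq> B \<and> card A \<le> N \<longrightarrow> (\<exists>c. witness A b e us q c)"
  proof (rule ccontr)
    assume "\<not> ?thesis"
    then obtain bad where bad: "\<And>q. bad q \<subseteq> B \<and> card (bad q) \<le> N \<and> (\<forall>c. \<not> witness (bad q) b e us q c)"
      by metis
    let ?A = "\<Union>q\<in>?Q. bad q"
    have "card ?A \<le> (\<Sum>q\<in>?Q. card (bad q))" by (rule card_UN_le[OF finite_qftps])
    also have "\<dots> \<le> card ?Q * N" using sum_bounded_above[of ?Q "\<lambda>q. card (bad q)" N] bad by simp
    also have "\<dots> < card B" by (rule large)
    finally have "?A \<noteq> B" by blast
    then have "?A \<subset> B" using bad by blast
    then have "\<exists>q\<in>?Q. \<exists>c. witness ?A b e us q c" by (intro w proper) auto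
    then obtain q c where q: "q \<in> ?Q" "witness ?A b e us q c" by (elim bexE exE)
    have "witness (bad q) b e us q c" by (rule witness_mono[OF _ q(2)]) (use q(1) in blast)
    then show False using bad by blast
  qed
  then show ?thesis using us that by blast
qed

text \<open>In \<open>D\<close>, each tuple is interpreted by a witness for the part of
  \<open>B\<close> that it meets. A small set embeds by means of a single witness, but an embedding
  of all of \<open>D\<close> would give one point related to \<open>k\<close> conjugates of
  \<open>e\<close> over the whole of \<open>B\<close>, where at most \<open>k - 1\<close> are
  possible.\<close>

lemma arbitrarily_large_constraints:
  assumes tern: "ternary V" and nontriv: "\<not> acl_trivial V M"
  shows "\<exists>F :: ('r, nat) struct. is_constraint V M F \<and> N < card (univ F)"
proof -
  \<comment> \<open>At least 3, so that every tuple occurring in a relation meets \<open>B\<close>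
    in a set having a witness.\<close>
  define m where "m = max 3 N"
  let ?Q = "(\<lambda>xs. qftp V M xs) ` {xs :: 'a list. length xs = 3}"
  \<comment> \<open>Two of the three extra points are \<open>b\<close> and \<open>e\<close>; the
    third makes the inequality \<open>cardB\<close> strict.\<close>
  obtain C where C: "circuit C" "card ?Q * m + 3 \<le> card C"
    using circuit_if_not_acl_trivial[OF nontriv] large_circuit by blast
  have fC: "finite C" "C \<subseteq> U" using C(1) by (auto simp: circuit_def)
  obtain b where b: "b \<in> C" using C(2) by fastforce
  have "card (C - {b}) \<noteq> 0" using b C(2) fC by (simp add: card_Diff_singleton)
  then obtain e where e: "e \<in> C" "e \<noteq> b" by (metis Diff_iff card.empty ex_in_conv insertI1)
  define B where "B = C - {b, e}"
  have C_eq: "C = insert b (insert e B)" "b \<notin> B" "e \<notin> B" using b e by (auto simp: B_def)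
  have B: "finite B" "B \<subseteq> U" and beU: "b \<in> U" "e \<in> U" using fC b e by (auto simp: B_def)
  have cardB: "card ?Q * m < card B" using C(2) C_eq B e by simp
  have "C - {b} - {e} = B" "C - {e} = insert b B" using C_eq e by auto
  moreover have "acl_indep (C - {b})" "e \<in> cl (C - {e})" using C(1) b e by (auto simp: circuit_def)
  ultimately have e_cl: "e \<notin> cl B" "e \<in> cl (insert b B)"
    using e by (auto simp: acl_indep_def)
  have b_cl: "b \<notin> cl (insert e A)" if AB: "A \<subset> B" for A
  proof -
    obtain x where "x \<in> B" "x \<notin> A" using AB by blast
    then have "x \<in> C" "x \<notin> insert b (insert e A)" "insert b (insert e A) \<subseteq> C"
      using AB C_eq by auto
    then have "insert b (insert e A) \<subset> C" by blast
    then have "acl_indep (insert b (insert e A))" using circuit_proper_indep[OF C(1)] by blast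
    moreover have "insert b (insert e A) - {b} = insert e A" using AB C_eq e by auto
    ultimately show ?thesis by (auto simp: acl_indep_def)
  qed
  \<comment> \<open>One more than the number of conjugates of \<open>e\<close> over \<open>B\<close>
    that can share a point.\<close>
  define k where "k = Suc (card (orb (insert b B) e))"
  obtain us q where us: "length us = k" "distinct us" "set us \<subseteq> orb B e"
    and "\<And>A. A \<subseteq> B \<Longrightarrow> card A \<le> m \<Longrightarrow> \<exists>c. witness A b e us q c"
    using ex_uniform_witnesses[OF B beU e_cl(1) b_cl cardB, of k] by blast
  then obtain c where w: "\<And>A. A \<subseteq> B \<Longrightarrow> card A \<le> m \<Longrightarrow> witness A b e us q (c A)"
    by metis
  let ?E = "set us"
  have usU: "?E \<subseteq> U" and us_ne: "us \<noteq> []" using us orb_subset[OF beU(2)] by (auto simp: k_def)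
  have BE: "B \<inter> ?E = {}"
  proof -
    have "u \<notin> B" if u: "u \<in> ?E" for u
    proof
      assume uB: "u \<in> B"
      obtain g where g: "g \<in> stab B" "u = g e" using us(3) u by (auto simp: orb_def)
      then have "g e = g u" using stab_fix[OF g(1) uB] by simp
      then have "e = u" using Aut_eq_iff[OF stab_Aut[OF g(1)]] beU u usU by blast
      then show False using uB C_eq by blast
    qed
    then show ?thesis by blast
  qed
  \<comment> \<open>This makes the embeddings of small subsets of \<open>D\<close>
    injective.\<close>
  have c_fresh: "c A \<in> U - (A \<union> ?E)" if A: "A \<subseteq> B" "card A \<le> m" for A
  proof -
    have ex: "\<exists>g\<in>stab A. g b = c A \<and> g e = u" if "u \<in> ?E" for u
      using w[OF A] that unfolding witness_def by blast
    obtain u0 where u0: "u0 \<in> ?E" using us_ne by fastforce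
    obtain g where g: "g \<in> stab A" "g b = c A" using ex[OF u0] by blast
    have "c A \<notin> A"
    proof
      assume cA: "c A \<in> A"
      then have "g b = g (c A)" using g stab_fix by metis
      then have "b = c A" using Aut_eq_iff[OF stab_Aut[OF g(1)]] beU cA A B by blast
      then show False using cA A C_eq by blast
    qed
    moreover have "c A \<notin> ?E"
    proof
      assume "c A \<in> ?E"
      then obtain g where "g \<in> stab A" "g b = c A" "g e = c A" using ex by blast
      then have "b = e" using Aut_eq_iff[of g b e] stab_Aut beU by metis
      then show False using e by blast
    qed
    moreover have "c A \<in> U" using g beU Aut_in stab_Aut by metis
    ultimately show ?thesis by blast
  qed
  define tr where "tr S = {a \<in> B. Some a \<in> S}" for S
  have tr_B: "tr S \<subseteq> B" for S by (auto simp: tr_def)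
  have tr_card: "card (tr S) \<le> card S" if "finite S" for S
    by (rule card_inj_on_le[of Some]) (use that in \<open>auto simp: tr_def\<close>)
  define X where "X = insert None (Some ` (B \<union> ?E))"
  \<comment> \<open>\<open>None\<close> plays the role of \<open>x\<close>; which witness interprets it depends on the tuple.\<close>
  define D where "D = \<lparr>univ = X, rel = \<lambda>R. {xs \<in> lists X. map (case_option (c (tr (set xs))) id) xs \<in> rel M R}\<rparr>"
  have len: "length xs = arity V R" "arity V R \<le> 3" if "R \<in> syms V" "map f xs \<in> rel M R"
    for R xs and f :: "'x \<Rightarrow> 'a"
  proof -
    have "length (map f xs) = arity V R" using that struct unfolding is_struct_def by blast
    then show "length xs = arity V R" by simp
    show "arity V R \<le> 3" using that(1) tern by (simp add: ternary_def)
  qed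
  have tr_small: "card (tr (set xs)) \<le> m" if "length xs \<le> 3" for xs
    using tr_card[of "set xs"] card_length[of xs] that by (simp add: m_def)
  have D: "is_struct V D" "finite (univ D)"
    using len B(1) by (auto simp: is_struct_def D_def X_def)
  have val_U: "case_option (c A) id x \<in> U"
    if "A \<subseteq> B" "card A \<le> m" "x \<in> insert None (Some ` (A \<union> ?E))" for A x
    using that c_fresh[OF that(1,2)] B(2) usU by auto
  \<comment> \<open>The witness for the trace of \<open>S\<close> serves all tuples from
    \<open>S\<close> at once: by \<open>witness_conjugate\<close> it agrees with the witnesses used
    to define \<open>D\<close>.\<close>
  have small: "permitted V M (restr D S)" if S: "S \<subseteq> X" "card S \<le> m" for S
  proof -
    have finS: "finite S" using S(1) B(1) finite_subset by (fastforce simp: X_def)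
    let ?A = "tr S"
    have A: "?A \<subseteq> B" "card ?A \<le> m" using tr_B tr_card[OF finS] S(2) by auto
    let ?f = "case_option (c ?A) id"
    have S_sub: "S \<subseteq> insert None (Some ` (?A \<union> ?E))" using S(1) by (auto simp: X_def tr_def)
    have "embedding V (restr D S) M ?f"
      unfolding embedding_def
    proof (intro conjI ballI)
      show "inj_on ?f (univ (restr D S))"
        using S_sub c_fresh[OF A] by (auto simp: restr_def inj_on_def split: option.splits)
      show "?f ` univ (restr D S) \<subseteq> U"
        using val_U[OF A] S_sub unfolding restr_def by (auto simp only: select_convs)
      fix R xs assume R: "R \<in> syms V" and "xs \<in> lists (univ (restr D S))"
      then have xs: "set xs \<subseteq> S" by (auto simp: restr_def)
      have mem: "xs \<in> rel (restr D S) R \<longleftrightarrow> map (case_option (c (tr (set xs))) id) xs \<in> rel M R"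
        using xs S(1) by (auto simp: restr_def D_def in_lists_conv_set)
      show "xs \<in> rel (restr D S) R \<longleftrightarrow> map ?f xs \<in> rel M R"
      proof (cases "length xs \<le> 3")
        case True
        have sub: "tr (set xs) \<subseteq> ?A" using xs by (auto simp: tr_def)
        have "set xs \<subseteq> insert None (Some ` (tr (set xs) \<union> ?E))"
          using xs S(1) by (auto simp: X_def tr_def)
        then obtain h where h: "h \<in> Aut"
          "map h (map (case_option (c (tr (set xs))) id) xs) = map ?f xs"
          using witness_conjugate[OF w[OF tr_B tr_small[OF True]] w[OF A] subset_refl sub _ beU us_ne usU _ True]
            tr_B B(2) by blast
        have "set (map (case_option (c (tr (set xs))) id) xs) \<subseteq> U"
          using \<open>set xs \<subseteq> insert None (Some ` (tr (set xs) \<union> ?E))\<close> val_U[OF tr_B tr_small[OF True]]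
          by (auto simp only: set_map)
        then show ?thesis using mem Aut_rel[OF h(1) R] h(2) by metis
      next
        case False
        \<comment> \<open>Tuples longer than 3 lie in no relation on either side.\<close>
        then show ?thesis unfolding mem using len[OF R] by (metis le_trans order_refl)
      qed
    qed
    then show ?thesis unfolding permitted_def by blast
  qed
  have forbidden: "\<not> permitted V M D"
  proof
    assume "permitted V M D"
    then obtain f where f: "embedding V D M f" by (auto simp: permitted_def)
    have finj: "inj_on f X" and fX: "f ` X \<subseteq> U" using f by (auto simp: embedding_def D_def)
    \<comment> \<open>Without \<open>None\<close>, the relations of \<open>D\<close> are those of
      \<open>M\<close>, so the embedding agrees there with an automorphism. Undoing it leaves a
      point \<open>c0\<close> in the role of \<open>None\<close> over the original \<open>B\<close>
      and \<open>us\<close>.\<close>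
    have "\<exists>g\<in>Aut. \<forall>x\<in>B \<union> ?E. g x = f (Some x)"
    proof (rule extend_partial)
      show "inj_on (\<lambda>x. f (Some x)) (B \<union> ?E)"
        using finj by (auto simp: inj_on_def X_def)
      fix R xs assume R: "R \<in> syms V" and xs: "xs \<in> lists (B \<union> ?E)"
      have "map Some xs \<in> lists (univ D)" using xs by (auto simp: D_def X_def)
      moreover have "map (case_option (c (tr (set (map Some xs)))) id) (map Some xs) = xs"
        by (simp add: o_def)
      ultimately show "xs \<in> rel M R \<longleftrightarrow> map (\<lambda>x. f (Some x)) xs \<in> rel M R"
        using embedding_relD[OF f R, of "map Some xs"] by (simp add: D_def o_def)
    qed (use B usU fX in \<open>auto simp: X_def\<close>)
    then obtain g where g: "g \<in> Aut" "\<And>x. x \<in> B \<union> ?E \<Longrightarrow> g x = f (Some x)" by blast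
    obtain g' where g': "g' \<in> Aut" "\<And>x. x \<in> U \<Longrightarrow> g' (g x) = x" "\<And>x. x \<in> U \<Longrightarrow> g (g' x) = x"
      using Aut_inv[OF g(1)] by blast
    define c0 where "c0 = g' (f None)"
    have fN: "f None \<in> U" using fX by (auto simp: X_def)
    have c0: "c0 \<in> U" "g c0 = f None" using fN g' Aut_in by (auto simp: c0_def)
    have c0_fresh: "c0 \<notin> B \<union> ?E"
    proof
      assume "c0 \<in> B \<union> ?E"
      then have "f (Some c0) = f None" "Some c0 \<in> X" "None \<in> X" using g(2) c0 by (auto simp: X_def)
      then show False using finj by (auto simp: inj_on_def)
    qed
    have "\<exists>h\<in>stab B. h b = c0 \<and> h e = u" if u: "u \<in> ?E" for u
    proof -
      \<comment> \<open>\<open>?\<tau>\<close> replaces \<open>b, e\<close> by \<open>None\<close>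
        and \<open>u\<close> inside \<open>D\<close>, and \<open>?\<phi>\<close> replaces them by
        \<open>c0\<close> and \<open>u\<close> inside \<open>M\<close>. Each tuple of length at most
        3 is handled with the witness for its own trace on \<open>B\<close>, and together these
        tuples give an automorphism over all of \<open>B\<close>.\<close>
      let ?\<phi> = "id(b := c0, e := u)" and ?\<tau> = "Some(b := None, e := Some u)"
      have gphi: "f (?\<tau> x) = g (?\<phi> x)" if "x \<in> C" for x
        using that C_eq g(2) u c0(2) by auto
      have "\<exists>h\<in>Aut. \<forall>x\<in>C. h x = ?\<phi> x"
      proof (rule extend_partial)
        show "inj_on ?\<phi> C"
          using C_eq c0_fresh BE u by (auto simp: inj_on_def)
        show "?\<phi> ` C \<subseteq> U" using C_eq c0 u usU B by auto
        fix R xs assume R: "R \<in> syms V" and xs: "xs \<in> lists C" and "length xs = arity V R"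
        then have l3: "length (map ?\<tau> xs) \<le> 3" using tern by (simp add: ternary_def)
        let ?T = "tr (set (map ?\<tau> xs))"
        have "?\<tau> x \<in> X" if "x \<in> C" for x
          using that C_eq u by (auto simp: X_def)
        then have \<tau>X: "map ?\<tau> xs \<in> lists (univ D)"
          using xs unfolding D_def by (auto simp only: select_convs set_map in_lists_conv_set)
        obtain gT where gT: "gT \<in> stab ?T" "gT b = c ?T" "gT e = u"
          using w[OF tr_B tr_small[OF l3]] u unfolding witness_def by blast
        have val: "case_option (c ?T) id (?\<tau> x) = gT x" if "x \<in> set xs" for x
        proof (cases "x = b \<or> x = e")
          case False
          then have "x \<in> B" using that xs C_eq by auto
          then have "x \<in> ?T" using False that by (force simp: tr_def)
          then show ?thesis using False stab_fix[OF gT(1)] by simp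
        qed (use gT e in auto)
        have "map (case_option (c ?T) id) (map ?\<tau> xs) = map gT xs"
          unfolding map_map o_def by (rule map_cong[OF refl val])
        moreover have "set xs \<subseteq> U" using xs fC by auto
        ultimately have "map ?\<tau> xs \<in> rel D R \<longleftrightarrow> xs \<in> rel M R"
          using \<tau>X Aut_rel[OF stab_Aut[OF gT(1)] R, of xs] by (simp add: D_def del: map_map)
        moreover have "map f (map ?\<tau> xs) = map g (map ?\<phi> xs)"
          using gphi xs by (auto simp: in_lists_conv_set)
        moreover have "set (map ?\<phi> xs) \<subseteq> U" using xs C_eq c0 u usU B by auto
        ultimately show "xs \<in> rel M R \<longleftrightarrow> map ?\<phi> xs \<in> rel M R"
          using embedding_relD[OF f R \<tau>X] Aut_rel[OF g(1) R, of "map ?\<phi> xs"] by metis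
      qed (use fC in auto)
      then obtain h where h: "h \<in> Aut" "\<And>x. x \<in> C \<Longrightarrow> h x = ?\<phi> x" by blast
      have "h \<in> stab B" using h C_eq by (auto simp: stab_def)
      moreover have "h b = c0" "h e = u" using h(2) C_eq e by auto
      ultimately show ?thesis by blast
    qed
    then have "card ?E \<le> card (orb (insert b B) e)"
      using finite_fibre_count[OF B(2) beU, of ?E c0] e_cl(2) by (auto simp: cl_def)
    moreover have "card ?E = k" using us distinct_card by metis
    ultimately show False by (simp add: k_def)
  qed
  obtain F :: "('r, nat) struct" and S where F: "is_constraint V M F" "S \<subseteq> X" "card S = card (univ F)"
    "\<not> permitted V M (restr D S)"
    using constraint_inside_forbidden[OF D forbidden] by (auto simp: D_def)
  \<comment> \<open>Sets of size at most \<open>m\<close> induce permitted structures, so the one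
    underlying the constraint is larger.\<close>
  then have "m < card (univ F)" using small[of S] by fastforce
  then show ?thesis using F(1) by (auto simp: m_def)
qed

end

theorem theorem4p2:
  fixes V :: "'r vocab" and M :: "('r, 'a) struct"
  assumes "ternary V"
    and "homogeneous V M"
    and "supersimple V M"
    and "SU_rank V M = 1"
    and "finitely_constrained V M"
  shows "acl_trivial V M"
proof (rule ccontr)
  assume nontriv: "\<not> acl_trivial V M"
  interpret rank_one_struct V M
    using rank_one_structI[OF assms(2)] assms(4) by simp
  obtain N where "\<forall>F :: ('r, nat) struct. is_constraint V M F \<longrightarrow> card (univ F) \<le> N"
    using constraint_card_bound[OF assms(5)] by blast
  then show False
    using arbitrarily_large_constraints[OF assms(1) nontriv, of N] by fastforce
qed

end
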